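(* Let $\ell\in\mathbb{N}$, $\ell\ge 1$, and let $\pi$ be an irreducible finite dimensional complex representation of $\mathrm{SO}(2\ell)$ of highest weight $\mathbf{m}=(m_1,m_2,\ldots,m_\ell)$. Let $a=\mathrm{diag}(1,1,\dots,1,-1)\in\mathrm{O}(2\ell)$ and let $\pi_\phi$ be the representation of $\mathrm{SO}(2\ell)$ given by $\pi_\phi(k)=\pi(aka)$. Then $\pi$ is equivalent to $\pi_\phi$ if and only if $m_\ell=0$.
   Context: Highest weight conventions for $\mathrm{SO}(2\ell)$: for $1\le i<k\le 2\ell$ let $I_{ki}$ be the $2\ell\times 2\ell$ matrix with $-1$ in the place $(k,i)$, $1$ in the place $(i,k)$ and zeros elsewhere; these form a basis of $\mathfrak{so}(2\ell)$. The complex span $\mathfrak{h}=\langle I_{21},I_{43},\dots,I_{2\ell,2\ell-1}\rangle_{\mathbb{C}}$ is a Cartan subalgebra of $\mathfrak{so}(2\ell,\mathbb{C})$. For $H=i(x_1I_{21}+\dots+x_\ell I_{2\ell,2\ell-1})\in\mathfrak{h}$ let $\epsilon_j\in\mathfrak{h}^*$ be given by $\epsilon_j(H)=x_j$, $1\le j\le\ell$. The positive roots are chosen as $\Delta^+=\{\epsilon_j+\epsilon_k,\ \epsilon_j-\epsilon_k: 1\le j<k\le\ell\}$. The highest weight $m_1\epsilon_1+\dots+m_\ell\epsilon_\ell$ of an irreducible representation is written $(m_1,\dots,m_\ell)$; it is a vector in $\mathbb{Z}^\ell$ with $m_1\ge m_2\ge\dots\ge m_{\ell-1}\ge|m_\ell|$.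 *)

theory Defs
  imports "HOL-Analysis.Analysis"
begin

text \<open>
  Matrices of size \<open>2\<ell>\<close> are indexed by a finite type \<open>'n\<close>. The numbering of rows and columns
  by \<open>1, \<dots>, 2\<ell>\<close> is given by a function \<open>idx\<close>, always assumed to be a bijection from \<open>{1..2 * \<ell>}\<close>
  onto \<open>UNIV :: 'n set\<close>. Representation spaces are \<open>\<complex>\<^sup>d\<close>, with \<open>d = CARD('d) \<ge> 1\<close>.
\<close>

definition SO :: "(real^'n^'n) set" where
  "SO = {A. rotation_matrix A}"

definition representation :: "(real^'n^'n \<Rightarrow> complex^'d^'d) \<Rightarrow> bool" where
  "representation \<pi> \<longleftrightarrow>
     \<pi> (mat 1) = mat 1 \<and>
     (\<forall>A\<in>SO. \<forall>B\<in>SO. \<pi> (A ** B) = \<pi> A ** \<pi> B) \<and>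
     continuous_on SO \<pi>"

definition irreducible_representation :: "(real^'n^'n \<Rightarrow> complex^'d^'d) \<Rightarrow> bool" where
  "irreducible_representation \<pi> \<longleftrightarrow>
     representation \<pi> \<and>
     (\<forall>W. vec.subspace W \<and> (\<forall>k\<in>SO. \<forall>w\<in>W. \<pi> k *v w \<in> W) \<longrightarrow> W = {0} \<or> W = UNIV)"

definition equivalent_representations ::
  "(real^'n^'n \<Rightarrow> complex^'d^'d) \<Rightarrow> (real^'n^'n \<Rightarrow> complex^'d^'d) \<Rightarrow> bool" where
  "equivalent_representations \<pi> \<rho> \<longleftrightarrow>
     (\<exists>T :: complex^'d^'d. invertible T \<and> (\<forall>k\<in>SO. T ** \<pi> k = \<rho> k ** T))"

text \<open>
  The multiplication \<open>*\<close> of the type \<open>vec\<close>, and hence its power, is componentwise, so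
  powers of a matrix are iterates of \<open>**\<close>.
\<close>

definition matrix_exp :: "real^'n^'n \<Rightarrow> real^'n^'n" where
  "matrix_exp X = (\<Sum>k. (1 / fact k) *\<^sub>R (((**) X ^^ k) (mat 1)))"

definition matrix_scale :: "complex \<Rightarrow> complex^'n^'m \<Rightarrow> complex^'n^'m" where
  "matrix_scale c X = (\<chi> r s. c * X $ r $ s)"

definition so_complex :: "(complex^'n^'n) set" where
  "so_complex = {X. transpose X = - X}"

definition lie_bracket :: "complex^'n^'n \<Rightarrow> complex^'n^'n \<Rightarrow> complex^'n^'n" where
  "lie_bracket X Y = X ** Y - Y ** X"

text \<open>
  The derived representation of the real Lie algebra of skew-symmetric matrices, and its
  complex linear extension; only its values on \<^const>\<open>so_complex\<close> are meaningful.
\<close>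

definition differential :: "(real^'n^'n \<Rightarrow> complex^'d^'d) \<Rightarrow> real^'n^'n \<Rightarrow> complex^'d^'d" where
  "differential \<pi> X = vector_derivative (\<lambda>t. \<pi> (matrix_exp (t *\<^sub>R X))) (at 0)"

definition differential_complex ::
  "(real^'n^'n \<Rightarrow> complex^'d^'d) \<Rightarrow> complex^'n^'n \<Rightarrow> complex^'d^'d" where
  "differential_complex \<pi> X =
     differential \<pi> (\<chi> r s. Re (X $ r $ s)) +
     matrix_scale \<i> (differential \<pi> (\<chi> r s. Im (X $ r $ s)))"

text \<open>The matrix \<open>I\<^bsub>ki\<^esub>\<close> for \<open>i < k\<close>.\<close>

definition basis_so :: "(nat \<Rightarrow> 'n) \<Rightarrow> nat \<Rightarrow> nat \<Rightarrow> complex^'n^'n" where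
  "basis_so idx k i =
     (\<chi> r s. if r = idx k \<and> s = idx i then -1
             else if r = idx i \<and> s = idx k then 1 else 0)"

text \<open>
  The element \<open>H = i(x\<^sub>1 I\<^sub>2\<^sub>1 + \<dots> + x\<^sub>\<ell> I\<^bsub>2\<ell>,2\<ell>-1\<^esub>)\<close> of the Cartan subalgebra. As \<open>x\<close> ranges over
  complex tuples, \<open>H\<close> ranges over the whole Cartan subalgebra.
\<close>

definition cartan :: "nat \<Rightarrow> (nat \<Rightarrow> 'n) \<Rightarrow> (nat \<Rightarrow> complex) \<Rightarrow> complex^'n^'n" where
  "cartan l idx x =
     matrix_scale \<i> (\<Sum>j=1..l. matrix_scale (x j) (basis_so idx (2*j) (2*j - 1)))"

text \<open>
  The functional \<open>c\<^sub>1 \<epsilon>\<^sub>1 + \<dots> + c\<^sub>\<ell> \<epsilon>\<^sub>\<ell>\<close> is represented by its coefficients \<open>c\<close>, of which only those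
  with index in \<open>{1..\<ell>}\<close> matter; \<open>weight_value l c x\<close> is its value on \<open>cartan l idx x\<close>.
\<close>

definition weight_value :: "nat \<Rightarrow> (nat \<Rightarrow> int) \<Rightarrow> (nat \<Rightarrow> complex) \<Rightarrow> complex" where
  "weight_value l c x = (\<Sum>j=1..l. of_int (c j) * x j)"

definition eps :: "nat \<Rightarrow> nat \<Rightarrow> int" where
  "eps j = (\<lambda>i. if i = j then 1 else 0)"

definition positive_roots :: "nat \<Rightarrow> (nat \<Rightarrow> int) set" where
  "positive_roots l =
     {\<lambda>i. eps j i + eps k i | j k. 1 \<le> j \<and> j < k \<and> k \<le> l} \<union>
     {\<lambda>i. eps j i - eps k i | j k. 1 \<le> j \<and> j < k \<and> k \<le> l}"

definition root_space :: "nat \<Rightarrow> (nat \<Rightarrow> 'n) \<Rightarrow> (nat \<Rightarrow> int) \<Rightarrow> (complex^'n^'n) set" where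
  "root_space l idx \<alpha> =
     {X \<in> so_complex. \<forall>x. lie_bracket (cartan l idx x) X = matrix_scale (weight_value l \<alpha> x) X}"

definition weight_vector ::
  "nat \<Rightarrow> (nat \<Rightarrow> 'n) \<Rightarrow> (real^'n^'n \<Rightarrow> complex^'d^'d) \<Rightarrow> (nat \<Rightarrow> int) \<Rightarrow> complex^'d \<Rightarrow> bool" where
  "weight_vector l idx \<pi> m v \<longleftrightarrow>
     v \<noteq> 0 \<and> (\<forall>x. differential_complex \<pi> (cartan l idx x) *v v = weight_value l m x *s v)"

definition highest_weight ::
  "nat \<Rightarrow> (nat \<Rightarrow> 'n) \<Rightarrow> (real^'n^'n \<Rightarrow> complex^'d^'d) \<Rightarrow> (nat \<Rightarrow> int) \<Rightarrow> bool" where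
  "highest_weight l idx \<pi> m \<longleftrightarrow>
     (\<exists>v. weight_vector l idx \<pi> m v \<and>
        (\<forall>\<alpha>\<in>positive_roots l. \<forall>X\<in>root_space l idx \<alpha>. differential_complex \<pi> X *v v = 0))"

text \<open>The matrix \<open>diag(1, \<dots>, 1, -1)\<close>.\<close>

definition reflection :: "nat \<Rightarrow> (nat \<Rightarrow> 'n) \<Rightarrow> real^'n^'n" where
  "reflection l idx = (\<chi> r s. if r = s then (if r = idx (2*l) then -1 else 1) else 0)"

definition twisted ::
  "nat \<Rightarrow> (nat \<Rightarrow> 'n) \<Rightarrow> (real^'n^'n \<Rightarrow> complex^'d^'d) \<Rightarrow> real^'n^'n \<Rightarrow> complex^'d^'d" where
  "twisted l idx \<pi> k = \<pi> (reflection l idx ** k ** reflection l idx)"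

end

theory Submission
  imports Defs
begin

text \<open>
  An irreducible representation is determined up to equivalence by its highest weight, so it is
  enough to find the highest weight of the twisted representation. Conjugation by
  \<open>diag(1, \<dots>, 1, -1)\<close> maps the Cartan element with coordinates \<open>(x\<^sub>1, \<dots>, x\<^sub>\<ell>)\<close> to the one
  with coordinates \<open>(x\<^sub>1, \<dots>, -x\<^sub>\<ell>)\<close>, and it permutes the positive root spaces: it exchanges
  \<open>\<epsilon>\<^sub>j + \<epsilon>\<^sub>\<ell>\<close> and \<open>\<epsilon>\<^sub>j - \<epsilon>\<^sub>\<ell>\<close> and fixes the other positive roots. A highest weight vector of
  \<open>\<pi>\<close> is therefore also one of the twisted representation, now with the weight
  \<open>(m\<^sub>1, \<dots>, -m\<^sub>\<ell>)\<close> (\<open>highest_weight_twisted\<close>). The two weights agree iff \<open>m\<^sub>\<ell> = 0\<close>.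

  The theorem of the highest weight is needed in the form
  \<open>equivalent_iff_same_highest_weight\<close>. Its algebraic core is elementary and avoids enveloping
  algebras. Let \<open>v\<close> be a highest weight vector and let \<open>W\<close> be the span of all words
  \<open>Y\<^sub>1 \<dots> Y\<^sub>k v\<close> in negative root vectors. The identity \<open>Z Y u = Y Z u + [Z, Y] u\<close> shows by
  induction on \<open>k\<close> that \<open>W\<close> is a submodule (\<open>span_words_invariant\<close>). One Cartan element, on
  which all positive roots are positive, has \<open>v\<close> as its only eigenvector in \<open>W\<close> of top
  eigenvalue, up to scalars, and all its other eigenvalues on \<open>W\<close> are lower
  (\<open>eigenvectors_in_span_words\<close>). Comparing two highest weight vectors of one irreducible
  representation gives uniqueness of the weight; applying the same statement to the submodule of
  \<open>\<pi> \<times> \<rho>\<close> generated by a pair of highest weight vectors of equal weight shows that this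
  submodule is the graph of an isomorphism.

  The passage between group and Lie algebra uses only continuity of the representation. The main
  point is that a continuous representation is Lipschitz at the identity (\<open>lipschitz_at_1\<close>).
  Hence the derivative of \<open>\<pi>\<close> along a curve through the identity depends only on the tangent
  vector of the curve (\<open>curve_has_vector_derivative\<close>), and linearity of the differential and its
  compatibility with brackets follow by choosing suitable curves. In the converse direction,
  every rotation is a product of exponentials of skew-symmetric matrices (\<open>SO_induct\<close>), so
  statements about the differential integrate to the group.
\<close>

section \<open>The matrix exponential\<close>

lemma bounded_bilinear_matrix_mult:
  "bounded_bilinear ((**) :: 'a::{real_normed_field,euclidean_space}^'m^'n \<Rightarrow> 'a^'p^'m \<Rightarrow> 'a^'p^'n)"
  unfolding bilinear_conv_bounded_bilinear[symmetric] bilinear_def linear_iff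
  by (auto simp: vec_eq_iff matrix_matrix_mult_def sum.distrib algebra_simps scaleR_sum_right)

lemma bounded_bilinear_matrix_vector_mult:
  "bounded_bilinear ((*v) :: 'a::{real_normed_field,euclidean_space}^'m^'n \<Rightarrow> 'a^'m \<Rightarrow> 'a^'n)"
  unfolding bilinear_conv_bounded_bilinear[symmetric] bilinear_def linear_iff
  by (auto simp: vec_eq_iff matrix_vector_mult_def sum.distrib algebra_simps scaleR_sum_right)

lemma bounded_linear_matrix_mult_both:
  fixes A :: "'a::{real_normed_field,euclidean_space}^'m^'n"
  shows "bounded_linear (\<lambda>X. A ** X ** B)"
  using bounded_linear_compose[OF bounded_bilinear.bounded_linear_left[OF bounded_bilinear_matrix_mult]
      bounded_bilinear.bounded_linear_right[OF bounded_bilinear_matrix_mult]] .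

lemmas matrix_mult_has_vector_derivative =
  bounded_bilinear.has_vector_derivative[OF bounded_bilinear_matrix_mult]

lemmas continuous_on_matrix_mult = bounded_bilinear.continuous_on[OF bounded_bilinear_matrix_mult]

lemmas matrix_mult_simps =
  bounded_bilinear.add_left[OF bounded_bilinear_matrix_mult]
  bounded_bilinear.add_right[OF bounded_bilinear_matrix_mult]
  bounded_bilinear.diff_left[OF bounded_bilinear_matrix_mult]
  bounded_bilinear.diff_right[OF bounded_bilinear_matrix_mult]
  bounded_bilinear.minus_left[OF bounded_bilinear_matrix_mult]
  bounded_bilinear.minus_right[OF bounded_bilinear_matrix_mult]
  bounded_bilinear.scaleR_left[OF bounded_bilinear_matrix_mult]
  bounded_bilinear.scaleR_right[OF bounded_bilinear_matrix_mult]
  bounded_bilinear.zero_left[OF bounded_bilinear_matrix_mult]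
  bounded_bilinear.zero_right[OF bounded_bilinear_matrix_mult]

text \<open>
  Derivatives of matrix-valued curves can thus be computed entry by entry, where the theory of scalar
  power series applies.
\<close>

lemma has_vector_derivative_componentwise:
  fixes f :: "real \<Rightarrow> 'a::real_normed_vector ^ 'n"
  assumes "\<And>i. ((\<lambda>t. f t $ i) has_vector_derivative D $ i) (at t within S)"
  shows "(f has_vector_derivative D) (at t within S)"
  unfolding has_vector_derivative_def has_derivative_within
proof
  show "bounded_linear (\<lambda>h. h *\<^sub>R D)" by (rule bounded_linear_scaleR_left)
  show "((\<lambda>y. (1 / norm (y - t)) *\<^sub>R (f y - (f t + (y - t) *\<^sub>R D))) \<longlongrightarrow> 0) (at t within S)"
    using assms
    by (intro vec_tendstoI) (simp add: has_vector_derivative_def has_derivative_within)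
qed

lemma bounded_linear_transpose: "bounded_linear (transpose :: real^'n^'m \<Rightarrow> real^'m^'n)"
  by (simp add: linear_conv_bounded_linear[symmetric] linear_iff vec_eq_iff transpose_def)

text \<open>
  The exponential is needed over both fields: the real one parametrizes the group, the complex one
  describes the representing matrices.
\<close>

definition mexp :: "'a::{real_normed_field,euclidean_space}^'n^'n \<Rightarrow> 'a^'n^'n" where
  "mexp X = (\<Sum>k. (1 / fact k) *\<^sub>R (((**) X ^^ k) (mat 1)))"

lemma matrix_exp_eq_mexp: "matrix_exp = mexp"
  by (simp add: fun_eq_iff matrix_exp_def mexp_def)

lemma matrix_power_scaleR:
  fixes X :: "'a::{real_normed_field,euclidean_space}^'n^'n"
  shows "((**) (t *\<^sub>R X) ^^ k) (mat 1) = t ^ k *\<^sub>R ((**) X ^^ k) (mat 1)"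
  by (induction k) (simp_all add: matrix_mult_simps)

lemma matrix_power_bound:
  fixes X :: "'a::{real_normed_field,euclidean_space}^'n^'n"
  obtains N K where "\<And>k. norm (((**) X ^^ k) (mat 1)) \<le> N * K ^ k"
proof -
  obtain K0 where K0: "K0 \<ge> 0" "\<And>(A :: 'a^'n^'n) (B :: 'a^'n^'n). norm (A ** B) \<le> norm A * norm B * K0"
    using bounded_bilinear.nonneg_bounded[OF bounded_bilinear_matrix_mult] by blast
  have "norm (((**) X ^^ k) (mat 1)) \<le> norm (mat 1 :: 'a^'n^'n) * (norm X * K0) ^ k" for k
  proof (induction k)
    case (Suc k)
    have "norm (((**) X ^^ Suc k) (mat 1)) \<le> norm X * norm (((**) X ^^ k) (mat 1)) * K0"
      using K0(2) by simp
    also have "\<dots> \<le> norm X * (norm (mat 1 :: 'a^'n^'n) * (norm X * K0) ^ k) * K0"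
      by (intro mult_right_mono mult_left_mono Suc K0) auto
    finally show ?case by (simp add: algebra_simps)
  qed simp
  then show ?thesis by (rule that)
qed

lemma summable_mexp:
  fixes X :: "'a::{real_normed_field,euclidean_space}^'n^'n"
  shows "summable (\<lambda>k. (1 / fact k) *\<^sub>R (((**) X ^^ k) (mat 1)))"
proof -
  obtain N K where NK: "\<And>k. norm (((**) X ^^ k) (mat 1)) \<le> N * K ^ k"
    using matrix_power_bound[of X] by blast
  have "summable (\<lambda>k. N * (inverse (fact k) * K ^ k))"
    by (intro summable_mult summable_exp)
  then show ?thesis
    by (rule summable_comparison_test')
       (use NK in \<open>simp add: divide_simps\<close>)
qed

lemma mexp_component:
  fixes X :: "'a::{real_normed_field,euclidean_space}^'n^'n"
  shows "mexp X $ r $ s = (\<Sum>k. (((**) X ^^ k) (mat 1)) $ r $ s / fact k)"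
    and "summable (\<lambda>k. (((**) X ^^ k) (mat 1)) $ r $ s / fact k)"
proof -
  have bl: "bounded_linear (\<lambda>A :: 'a^'n^'n. A $ r $ s)"
    using bounded_linear_compose[OF bounded_linear_vec_nth bounded_linear_vec_nth] .
  have eq: "((1 / fact k) *\<^sub>R (((**) X ^^ k) (mat 1))) $ r $ s = (((**) X ^^ k) (mat 1)) $ r $ s / fact k" for k
    unfolding vector_scaleR_component by (simp add: scaleR_conv_of_real[where 'a = 'a] divide_inverse mult.commute)
  show "mexp X $ r $ s = (\<Sum>k. (((**) X ^^ k) (mat 1)) $ r $ s / fact k)"
    unfolding mexp_def bounded_linear.suminf[OF bl summable_mexp] eq ..
  show "summable (\<lambda>k. (((**) X ^^ k) (mat 1)) $ r $ s / fact k)"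
    using bounded_linear.summable[OF bl summable_mexp[of X]] by (simp only: eq)
qed

lemma mexp_0 [simp]: "mexp (0 :: 'a::{real_normed_field,euclidean_space}^'n^'n) = mat 1"
proof -
  have "(1 / fact k) *\<^sub>R ((**) (0 :: 'a^'n^'n) ^^ k) (mat 1) = (if k = 0 then mat 1 else 0)" for k
    by (cases k) (simp_all add: matrix_mult_simps)
  then show ?thesis
    unfolding mexp_def using sums_single[of 0 "\<lambda>_. mat 1 :: 'a^'n^'n"] by (simp add: sums_iff)
qed

text \<open>
  Each entry of \<open>exp(tX)\<close> is a scalar power series in \<open>t\<close>; differentiating it termwise shifts
  the powers of \<open>X\<close> by one, which is multiplication by \<open>X\<close>.
\<close>

lemma mexp_has_vector_derivative:
  fixes X :: "'a::{real_normed_field,euclidean_space}^'n^'n"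
  shows "((\<lambda>t. mexp (t *\<^sub>R X)) has_vector_derivative X ** mexp (t *\<^sub>R X)) (at t)"
proof (intro has_vector_derivative_componentwise)
  fix r s
  define P where "P k = ((**) X ^^ k) (mat 1)" for k
  define c where "c s' r' k = P k $ r' $ s' / fact k" for s' r' k
  obtain N K where NK: "\<And>k. norm (P k) \<le> N * K ^ k"
    unfolding P_def using matrix_power_bound[of X] by blast
  have sm: "summable (\<lambda>k. c s' r' k * y ^ k)" for s' r' and y :: 'a
  proof -
    have "summable (\<lambda>k. N * (inverse (fact k) * (K * norm y) ^ k))"
      by (intro summable_mult summable_exp)
    then show ?thesis
    proof (rule summable_comparison_test')
      fix k
      have "norm (P k $ r' $ s') \<le> N * K ^ k"
        using NK[of k] Finite_Cartesian_Product.norm_nth_le[of "P k $ r'" s'] Finite_Cartesian_Product.norm_nth_le[of "P k" r'] by linarith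
      then have "norm (P k $ r' $ s') * norm y ^ k \<le> N * K ^ k * norm y ^ k"
        by (intro mult_right_mono) auto
      then show "norm (c s' r' k * y ^ k) \<le> N * (inverse (fact k) * (K * norm y) ^ k)"
        by (simp add: c_def norm_mult norm_divide norm_power power_mult_distrib field_simps)
    qed
  qed
  have ent: "mexp (u *\<^sub>R X) $ r' $ s' = (\<Sum>k. c s' r' k * of_real u ^ k)" for u r' s'
    unfolding mexp_component(1) matrix_power_scaleR c_def P_def vector_scaleR_component
    by (simp add: scaleR_conv_of_real[where 'a = 'a] mult.commute)
  have dc: "diffs (c s r) k = (\<Sum>j\<in>UNIV. X $ r $ j * c s j k)" for k
  proof -
    have "diffs (c s r) k = P (Suc k) $ r $ s / fact k"
      by (simp add: diffs_def c_def del: of_nat_Suc)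
    also have "P (Suc k) = X ** P k" by (simp add: P_def)
    finally have "diffs (c s r) k = (X ** P k) $ r $ s / fact k" .
    also have "\<dots> = (\<Sum>j\<in>UNIV. X $ r $ j * c s j k)"
      by (simp add: c_def matrix_matrix_mult_def sum_divide_distrib)
    finally show ?thesis .
  qed
  have "(\<Sum>k. diffs (c s r) k * of_real t ^ k) = (\<Sum>k. \<Sum>j\<in>UNIV. X $ r $ j * (c s j k * of_real t ^ k))"
    by (simp add: dc sum_distrib_right mult.assoc)
  also have "\<dots> = (\<Sum>j\<in>UNIV. \<Sum>k. X $ r $ j * (c s j k * of_real t ^ k))"
    by (intro suminf_sum summable_mult sm)
  also have "\<dots> = (X ** mexp (t *\<^sub>R X)) $ r $ s"
    by (simp add: suminf_mult[OF sm] ent matrix_matrix_mult_def)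
  finally have eq: "(\<Sum>k. diffs (c s r) k * of_real t ^ k) = (X ** mexp (t *\<^sub>R X)) $ r $ s" .
  have "((\<lambda>z. \<Sum>k. c s r k * z ^ k) has_field_derivative (X ** mexp (t *\<^sub>R X)) $ r $ s) (at (of_real t))"
    using termdiffs_strong_converges_everywhere[of "c s r" "of_real t", OF sm] unfolding eq .
  moreover have "(of_real has_vector_derivative (1::'a)) (at t)"
    unfolding has_vector_derivative_def
    using bounded_linear_imp_has_derivative[OF bounded_linear_of_real, of "at t"]
    by (simp add: scaleR_conv_of_real)
  ultimately have "((\<lambda>z. \<Sum>k. c s r k * z ^ k) \<circ> of_real has_vector_derivative
      1 * (X ** mexp (t *\<^sub>R X)) $ r $ s) (at t)"
    by (intro field_vector_diff_chain_at)
  then show "((\<lambda>t. mexp (t *\<^sub>R X) $ r $ s) has_vector_derivative (X ** mexp (t *\<^sub>R X)) $ r $ s) (at t)"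
    by (simp add: ent o_def)
qed

lemma mexp_commutes:
  fixes X :: "'a::{real_normed_field,euclidean_space}^'n^'n"
  shows "X ** mexp (t *\<^sub>R X) = mexp (t *\<^sub>R X) ** X"
proof -
  have c: "X ** ((**) (t *\<^sub>R X) ^^ k) (mat 1) = ((**) (t *\<^sub>R X) ^^ k) (mat 1) ** X" for k
  proof (induction k)
    case (Suc k)
    have "X ** ((t *\<^sub>R X) ** ((**) (t *\<^sub>R X) ^^ k) (mat 1))
        = (t *\<^sub>R X) ** (X ** ((**) (t *\<^sub>R X) ^^ k) (mat 1))"
      by (simp add: matrix_mult_simps)
    then show ?case by (simp add: Suc matrix_mul_assoc)
  qed simp
  have "X ** mexp (t *\<^sub>R X) = (\<Sum>k. X ** ((1 / fact k) *\<^sub>R ((**) (t *\<^sub>R X) ^^ k) (mat 1)))"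
    unfolding mexp_def
    by (rule bounded_linear.suminf[OF bounded_bilinear.bounded_linear_right[OF bounded_bilinear_matrix_mult] summable_mexp])
  also have "\<dots> = (\<Sum>k. ((1 / fact k) *\<^sub>R ((**) (t *\<^sub>R X) ^^ k) (mat 1)) ** X)"
    by (simp add: matrix_mult_simps c)
  also have "\<dots> = mexp (t *\<^sub>R X) ** X"
    unfolding mexp_def
    by (rule bounded_linear.suminf[OF bounded_bilinear.bounded_linear_left[OF bounded_bilinear_matrix_mult] summable_mexp, symmetric])
  finally show ?thesis .
qed

lemma constant_of_zero_vector_derivative:
  fixes f :: "real \<Rightarrow> 'a::real_normed_vector"
  assumes "\<And>t. (f has_vector_derivative 0) (at t)"
  shows "f s = f t"
proof -
  obtain c where "\<And>x. x \<in> UNIV \<Longrightarrow> f x = c"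
    using has_vector_derivative_zero_constant[of UNIV f] assms by auto
  then show ?thesis by simp
qed

lemma mexp_minus_has_vector_derivative:
  fixes X :: "'a::{real_normed_field,euclidean_space}^'n^'n"
  shows "((\<lambda>t. mexp (- t *\<^sub>R X)) has_vector_derivative - (X ** mexp (- t *\<^sub>R X))) (at t)"
proof -
  have "(uminus has_vector_derivative (-1::real)) (at t)"
    by (auto intro!: derivative_eq_intros)
  from vector_diff_chain_at[OF this mexp_has_vector_derivative[of X]] show ?thesis
    by (simp add: o_def)
qed

text \<open>
  The derivative of \<open>exp(-tX) F(t)\<close> vanishes by the product rule, because \<open>X\<close> commutes with its
  exponential.
\<close>

lemma mexp_ode_aux:
  fixes X :: "'a::{real_normed_field,euclidean_space}^'n^'n"
  assumes "\<And>t. (F has_vector_derivative X ** F t) (at t)"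
  shows "mexp (- t *\<^sub>R X) ** F t = F 0"
proof -
  have "((\<lambda>t. mexp (- t *\<^sub>R X) ** F t) has_vector_derivative 0) (at t)" for t
  proof -
    have "mexp (- t *\<^sub>R X) ** (X ** F t) + - (X ** mexp (- t *\<^sub>R X)) ** F t = 0"
      by (simp add: matrix_mul_assoc mexp_commutes[of X "-t"] matrix_mult_simps del: scaleR_minus_left)
    then show ?thesis
      using matrix_mult_has_vector_derivative[OF mexp_minus_has_vector_derivative[of X] assms[of t]] by simp
  qed
  from constant_of_zero_vector_derivative[OF this, of t 0] show ?thesis by simp
qed

lemma mexp_minus_left: "mexp (- t *\<^sub>R X) ** mexp (t *\<^sub>R X) = mat 1"
  using mexp_ode_aux[where F = "\<lambda>t. mexp (t *\<^sub>R X)" and t = t, OF mexp_has_vector_derivative] by simp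

lemma mexp_minus_right: "mexp (t *\<^sub>R X) ** mexp (- t *\<^sub>R X) = mat 1"
  using mexp_minus_left[where t = "-t" and X = X] by simp

text \<open>
  A linear equation \<open>F' = X F\<close> determines its solution from the initial value. The addition theorem
  and the identification of concrete one-parameter groups as exponentials are obtained from this.
\<close>

lemma mexp_ode_unique:
  fixes X :: "'a::{real_normed_field,euclidean_space}^'n^'n"
  assumes "\<And>t. (F has_vector_derivative X ** F t) (at t)"
  shows "F t = mexp (t *\<^sub>R X) ** F 0"
  using mexp_ode_aux[where F = F and t = t, OF assms]
  by (metis matrix_mul_assoc matrix_mul_lid mexp_minus_right)

lemma mexp_add:
  fixes X :: "'a::{real_normed_field,euclidean_space}^'n^'n"
  shows "mexp ((s + t) *\<^sub>R X) = mexp (s *\<^sub>R X) ** mexp (t *\<^sub>R X)"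
proof -
  have "((\<lambda>s. mexp ((s + t) *\<^sub>R X)) has_vector_derivative X ** mexp ((s + t) *\<^sub>R X)) (at s)" for s
  proof -
    have "((\<lambda>s. s + t) has_vector_derivative (1::real)) (at s)"
      by (auto intro!: derivative_eq_intros)
    from vector_diff_chain_at[OF this mexp_has_vector_derivative[of X]] show ?thesis
      by (simp add: o_def)
  qed
  from mexp_ode_unique[where F = "\<lambda>s. mexp ((s + t) *\<^sub>R X)", OF this] show ?thesis by simp
qed

lemma continuous_on_mexp:
  fixes X :: "'a::{real_normed_field,euclidean_space}^'n^'n"
  shows "continuous_on S (\<lambda>t. mexp (t *\<^sub>R X))"
  by (intro continuous_at_imp_continuous_on ballI has_vector_derivative_continuous[OF mexp_has_vector_derivative])

lemma continuous_on_det: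
  fixes F :: "'b::topological_space \<Rightarrow> real^'n^'n"
  assumes "continuous_on S F"
  shows "continuous_on S (\<lambda>t. det (F t))"
  unfolding det_def by (intro continuous_intros assms)

lemma SO_iff: "A \<in> SO \<longleftrightarrow> orthogonal_matrix A \<and> det A = 1"
  by (simp add: SO_def rotation_matrix_def)

lemma SO_1 [simp]: "mat 1 \<in> SO"
  by (simp add: SO_iff orthogonal_matrix_id)

lemma SO_mult [intro]: "A \<in> SO \<Longrightarrow> B \<in> SO \<Longrightarrow> A ** B \<in> SO"
  by (simp add: SO_iff orthogonal_matrix_mul det_mul)

lemma SO_transpose [intro]: "A \<in> SO \<Longrightarrow> transpose A \<in> SO"
  by (simp add: SO_iff)

lemma SO_transpose_mult: "A \<in> SO \<Longrightarrow> transpose A ** A = mat 1" "A \<in> SO \<Longrightarrow> A ** transpose A = mat 1"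
  by (simp_all add: SO_iff orthogonal_matrix_def)

text \<open>
  Orthogonality holds since the derivative of \<open>exp(tX)\<^sup>T exp(tX)\<close> is zero for skew-symmetric \<open>X\<close>.
  The determinant is then a continuous function of \<open>t\<close> with values in \<open>{1, -1}\<close>, so it keeps its
  value at \<open>t = 0\<close>.
\<close>

lemma mexp_skew_SO:
  fixes X :: "real^'n^'n"
  assumes "transpose X = - X"
  shows "mexp (t *\<^sub>R X) \<in> SO"
proof -
  have "((\<lambda>t. transpose (mexp (t *\<^sub>R X)) ** mexp (t *\<^sub>R X)) has_vector_derivative 0) (at t)" for t
  proof -
    have d: "((\<lambda>t. transpose (mexp (t *\<^sub>R X))) has_vector_derivative transpose (X ** mexp (t *\<^sub>R X))) (at t)"
      by (intro bounded_linear.has_vector_derivative[OF bounded_linear_transpose] mexp_has_vector_derivative)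
    have "transpose (mexp (t *\<^sub>R X)) ** (X ** mexp (t *\<^sub>R X)) + transpose (X ** mexp (t *\<^sub>R X)) ** mexp (t *\<^sub>R X) = 0"
      by (simp add: matrix_transpose_mul assms matrix_mult_simps matrix_mul_assoc)
    then show ?thesis
      using matrix_mult_has_vector_derivative[OF d mexp_has_vector_derivative[of X t]] by simp
  qed
  from constant_of_zero_vector_derivative[OF this, of _ 0]
  have orth: "orthogonal_matrix (mexp (t *\<^sub>R X))" for t
    by (simp add: orthogonal_matrix)
  have "continuous_on UNIV (\<lambda>t. det (mexp (t *\<^sub>R X)))"
    by (intro continuous_on_det continuous_on_mexp)
  moreover have "finite (range (\<lambda>t. det (mexp (t *\<^sub>R X))))"
    by (rule finite_subset[of _ "{1, -1}"]) (use det_orthogonal_matrix[OF orth] in auto)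
  ultimately have "(\<lambda>t. det (mexp (t *\<^sub>R X))) constant_on UNIV"
    by (intro continuous_finite_range_constant) auto
  then have "det (mexp (t *\<^sub>R X)) = det (mexp (0 *\<^sub>R X))"
    unfolding constant_on_def by (metis UNIV_I)
  then show ?thesis
    by (simp add: SO_iff orth)
qed

section \<open>Generation of the rotation group by exponentials\<close>

definition skew_unit :: "'n \<Rightarrow> 'n \<Rightarrow> real^'n^'n" where
  "skew_unit p q = (\<chi> r s. if r = p \<and> s = q then 1 else if r = q \<and> s = p then -1 else 0)"

definition plane_rotation :: "'n \<Rightarrow> 'n \<Rightarrow> real \<Rightarrow> real^'n^'n" where
  "plane_rotation p q t =
     (\<chi> r s. if r = s \<and> r \<in> {p, q} then cos t
             else if r = p \<and> s = q then sin t
             else if r = q \<and> s = p then - sin t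
             else if r = s then 1 else 0)"

lemma transpose_skew_unit: "p \<noteq> q \<Longrightarrow> transpose (skew_unit p q) = - skew_unit p q"
  by (auto simp: skew_unit_def vec_eq_iff transpose_def)

lemma skew_unit_mult:
  fixes A :: "real^'n^'n"
  assumes "p \<noteq> q"
  shows "(skew_unit p q ** A) $ r $ s = (if r = p then A $ q $ s else if r = q then - A $ p $ s else 0)"
proof -
  have "(skew_unit p q ** A) $ r $ s =
      (\<Sum>k\<in>UNIV. (if k = q then (if r = p then A $ q $ s else 0) else 0) +
                  (if k = p then (if r = q then - A $ p $ s else 0) else 0))"
    unfolding matrix_matrix_mult_def vec_lambda_beta
    by (rule sum.cong) (use assms in \<open>auto simp: skew_unit_def\<close>)
  then show ?thesis
    using assms by (simp add: sum.distrib)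
qed

text \<open>
  Both sides solve \<open>F' = E F\<close> with \<open>F(0) = 1\<close>, where \<open>E\<close> is the generator
  \<open>skew_unit p q\<close>.
\<close>

lemma plane_rotation_eq_mexp:
  assumes "p \<noteq> q"
  shows "plane_rotation p q t = mexp (t *\<^sub>R skew_unit p q)"
proof -
  have "(plane_rotation p q has_vector_derivative skew_unit p q ** plane_rotation p q t) (at t)" for t
  proof (intro has_vector_derivative_componentwise)
    fix r s
    show "((\<lambda>t. plane_rotation p q t $ r $ s) has_vector_derivative
        (skew_unit p q ** plane_rotation p q t) $ r $ s) (at t)"
      unfolding skew_unit_mult[OF assms] has_real_derivative_iff_has_vector_derivative[symmetric]
      using assms by (auto simp: plane_rotation_def intro!: derivative_eq_intros)
  qed
  from mexp_ode_unique[OF this, of t]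
  have "plane_rotation p q t = mexp (t *\<^sub>R skew_unit p q) ** plane_rotation p q 0" .
  also have "plane_rotation p q 0 = mat 1"
    by (simp add: plane_rotation_def mat_def vec_eq_iff)
  finally show ?thesis by simp
qed

lemma plane_rotation_axis:
  assumes "p \<noteq> q"
  shows "plane_rotation p q t *v axis p 1 = cos t *\<^sub>R axis p 1 - sin t *\<^sub>R axis q 1"
    and "i \<noteq> p \<Longrightarrow> i \<noteq> q \<Longrightarrow> plane_rotation p q t *v axis i 1 = axis i 1"
  unfolding matrix_vector_mult_basis
  using assms by (auto simp: column_def plane_rotation_def vec_eq_iff axis_def)

text \<open>
  This is the step of Givens elimination, by induction on the support of \<open>u\<close>: one coordinate \<open>k\<close> is
  split off as \<open>u = c u' + u\<^sub>k e\<^sub>k\<close> with a unit vector \<open>u'\<close> of smaller support, the coefficients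
  are produced by a rotation in the plane of \<open>e\<^sub>j\<close> and \<open>e\<^sub>k\<close>, and \<open>e\<^sub>j\<close> is then moved to \<open>u'\<close>
  with \<open>e\<^sub>k\<close> held fixed. The support always retains a second index \<open>k0\<close>, since a unit vector supported on \<open>{j}\<close>
  alone could be \<open>- e\<^sub>j\<close>, which no rotation fixing the other axes reaches.
\<close>

lemma rotate_axis_onto:
  fixes G :: "(real^'n^'n) set" and u :: "real^'n"
  assumes rot: "\<And>p q t. p \<noteq> q \<Longrightarrow> plane_rotation p q t \<in> G"
    and mult: "\<And>A B. A \<in> G \<Longrightarrow> B \<in> G \<Longrightarrow> A ** B \<in> G"
    and "finite L" "j \<noteq> k0" "norm u = 1" "\<And>i. i \<notin> insert j (insert k0 L) \<Longrightarrow> u $ i = 0"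
  shows "\<exists>h\<in>G. (\<forall>i. i \<notin> insert j (insert k0 L) \<longrightarrow> h *v axis i 1 = axis i 1) \<and> h *v axis j 1 = u"
  using assms(3,5,6)
proof (induction L arbitrary: u rule: finite_induct)
  case empty
  have "1 = u \<bullet> u" using empty by (simp add: norm_eq_1)
  also have "\<dots> = (\<Sum>i\<in>{j, k0}. u $ i * u $ i)"
    unfolding inner_vec_def by (rule sum.mono_neutral_cong_right) (use empty in auto)
  finally have "(u $ j)\<^sup>2 + (- u $ k0)\<^sup>2 = 1"
    using \<open>j \<noteq> k0\<close> by (simp add: power2_eq_square)
  then obtain t where t: "u $ j = cos t" "- u $ k0 = sin t"
    by (rule sincos_total_2pi)
  have "plane_rotation j k0 t *v axis j 1 = u"
    unfolding plane_rotation_axis(1)[OF \<open>j \<noteq> k0\<close>] t[symmetric]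
    using empty \<open>j \<noteq> k0\<close> by (auto simp: vec_eq_iff axis_def)
  then show ?case
    using rot[OF \<open>j \<noteq> k0\<close>] plane_rotation_axis(2)[OF \<open>j \<noteq> k0\<close>] by (intro bexI[of _ "plane_rotation j k0 t"]) auto
next
  case (insert k L)
  show ?case
  proof (cases "k \<in> {j, k0}")
    case True
    then have "insert j (insert k0 (insert k L)) = insert j (insert k0 L)" by auto
    then show ?thesis using insert.IH[OF insert.prems(1)] insert.prems(2) by simp
  next
    case False
    define c where "c = sqrt (1 - (u $ k)\<^sup>2)"
    define w where "w = u - u $ k *\<^sub>R axis k 1"
    have uk: "(u $ k)\<^sup>2 \<le> 1"
      using component_le_norm_cart[of u k] insert.prems(1) by (simp add: abs_square_le_1)
    have "w \<bullet> w = u \<bullet> u - (u $ k)\<^sup>2"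
      by (simp add: w_def inner_diff_left inner_diff_right inner_axis inner_axis' power2_eq_square)
    then have ww: "norm w = c"
      using insert.prems(1) by (simp add: c_def norm_eq_sqrt_inner)
    \<comment> \<open>For \<open>c = 0\<close> the vector \<open>u\<close> is a multiple of \<open>e\<^sub>k\<close>, and any unit vector off \<open>k\<close> serves.\<close>
    define u' where "u' = (if c = 0 then axis j 1 else (1 / c) *\<^sub>R w)"
    have u: "u = c *\<^sub>R u' + u $ k *\<^sub>R axis k 1"
    proof (cases "c = 0")
      case True
      then have "w = 0" using ww by simp
      then show ?thesis using True by (simp add: w_def)
    qed (simp add: u'_def w_def)
    have "norm u' = 1" using ww by (auto simp: u'_def)
    moreover have "u' $ i = 0" if "i \<notin> insert j (insert k0 L)" for i
      using that insert.prems(2)[of i] by (auto simp: u'_def w_def axis_def)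
    ultimately obtain h where h: "h \<in> G" "\<And>i. i \<notin> insert j (insert k0 L) \<Longrightarrow> h *v axis i 1 = axis i 1"
        "h *v axis j 1 = u'"
      using insert.IH by meson
    have "c\<^sup>2 + (- u $ k)\<^sup>2 = 1" using uk by (simp add: c_def)
    then obtain t where t: "c = cos t" "- u $ k = sin t"
      by (rule sincos_total_2pi)
    have jk: "j \<noteq> k" using False by auto
    have k: "h *v axis k 1 = axis k 1" using h(2) False insert.hyps by auto
    have "(h ** plane_rotation j k t) *v axis j 1 = u"
      unfolding matrix_vector_mul_assoc[symmetric] plane_rotation_axis(1)[OF jk] t[symmetric]
      by (subst (2) u) (simp add: algebra_simps h k del: vector_scaleR_component)
    moreover have "(h ** plane_rotation j k t) *v axis i 1 = axis i 1"
      if "i \<notin> insert j (insert k0 (insert k L))" for i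
      using that by (simp add: matrix_vector_mul_assoc[symmetric] plane_rotation_axis(2)[OF jk] h(2))
    ultimately show ?thesis
      using mult[OF h(1) rot[OF jk]] by blast
  qed
qed

text \<open>
  If all axes but one are fixed, orthogonality makes the matrix diagonal, and the determinant leaves
  only the entry \<open>1\<close> for the last axis.
\<close>

lemma SO_matrix_eq_1:
  fixes A :: "real^'n^'n"
  assumes "A \<in> SO" and fixes_axis: "\<And>i. i \<noteq> j \<Longrightarrow> A *v axis i 1 = axis i 1"
  shows "A = mat 1"
proof -
  have orth: "orthogonal_matrix A" and det: "det A = 1" using assms by (simp_all add: SO_iff)
  have col: "A $ r $ s = (if r = s then 1 else 0)" if "s \<noteq> j" for r s
    using fixes_axis[OF that] unfolding matrix_vector_mult_basis by (simp add: vec_eq_iff column_def axis_def)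
  have colj: "A $ r $ j = 0" if "r \<noteq> j" for r
  proof -
    have "(A *v axis j 1) \<bullet> (A *v axis r 1) = axis j (1::real) \<bullet> axis r 1"
      using orth orthogonal_transformation_matrix[of "(*v) A"] by (simp add: orthogonal_transformation_def)
    then show ?thesis
      unfolding fixes_axis[OF that] using that
      unfolding matrix_vector_mult_basis by (simp add: inner_axis column_def) (simp add: axis_def)
  qed
  have "det A = (\<Prod>i\<in>UNIV. A $ i $ i)"
    by (rule det_diagonal) (metis col colj)
  also have "\<dots> = (\<Prod>i\<in>UNIV. if i = j then A $ j $ j else 1)"
    by (intro prod.cong) (auto simp: col)
  finally have "A $ j $ j = 1" using det by (simp)
  then have "A $ r $ s = (if r = s then 1 else 0)" for r s
    by (cases "s = j") (auto simp: col colj)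
  then show ?thesis
    by (simp add: vec_eq_iff mat_def)
qed

text \<open>
  The rotations in coordinate planes are exponentials. As long as two axes are moved, composing with a
  product of such rotations fixes one more axis, so the induction runs on the number of moved axes.
\<close>

theorem SO_induct [consumes 1, case_names mexp mult]:
  fixes A :: "real^'n^'n"
  assumes "A \<in> SO"
    and mexp: "\<And>X. transpose X = - X \<Longrightarrow> P (mexp X)"
    and mult: "\<And>A B. A \<in> SO \<Longrightarrow> B \<in> SO \<Longrightarrow> P A \<Longrightarrow> P B \<Longrightarrow> P (A ** B)"
  shows "P A"
proof -
  define G where "G = {A \<in> SO. P A}"
  have rot: "plane_rotation p q t \<in> G" if "p \<noteq> q" for p q :: 'n and t
    using that mexp[of "t *\<^sub>R skew_unit p q"] mexp_skew_SO[OF transpose_skew_unit[OF that], of t]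
    by (simp add: G_def plane_rotation_eq_mexp transpose_scalar transpose_skew_unit)
  have mult_G: "A ** B \<in> G" if "A \<in> G" "B \<in> G" for A B
    using that mult by (auto simp: G_def)
  define fixed where "fixed A = {i. A *v axis i 1 = axis i 1}" for A :: "real^'n^'n"
  have "A \<in> G" using \<open>A \<in> SO\<close>
  proof (induction "card (- fixed A)" arbitrary: A rule: less_induct)
    case less
    show ?case
    proof (cases "\<exists>j. - fixed A \<subseteq> {j}")
      case True
      then obtain j where "\<And>i. i \<noteq> j \<Longrightarrow> A *v axis i 1 = axis i 1"
        by (auto simp: fixed_def)
      then have "A = mat 1" using SO_matrix_eq_1 less.prems by blast
      moreover have "P (mat 1)" using mexp[of 0] by (simp add: vec_eq_iff transpose_def)
      ultimately show ?thesis by (simp add: G_def)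
    next
      case False
      then obtain j where j: "j \<notin> fixed A" by auto
      with False obtain k0 where k0: "k0 \<notin> fixed A" "j \<noteq> k0" by auto
      define u where "u = A *v axis j 1"
      have pres: "(A *v x) \<bullet> (A *v y) = x \<bullet> y" for x y
        using less.prems orthogonal_transformation_matrix[of "(*v) A"]
        by (simp add: orthogonal_transformation_def SO_iff)
      have "norm u = 1" by (simp add: u_def norm_eq_1 pres inner_axis_axis)
      moreover have "u $ i = 0" if "i \<notin> insert j (insert k0 (- fixed A))" for i
      proof -
        from that have "A *v axis i 1 = axis i 1" and "i \<noteq> j" by (auto simp: fixed_def)
        then show ?thesis
          using pres[of "axis j 1" "axis i 1"] by (simp add: u_def inner_axis) (simp add: axis_def)
      qed
      ultimately obtain h where h: "h \<in> G"
          "\<And>i. i \<notin> insert j (insert k0 (- fixed A)) \<Longrightarrow> h *v axis i 1 = axis i 1" "h *v axis j 1 = u"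
        using rotate_axis_onto[of G "- fixed A" j k0 u, OF rot mult_G _ k0(2)] by (auto simp: finite)
      have hSO: "h \<in> SO" using h by (simp add: G_def)
      have undo: "transpose h *v (h *v x) = x" for x
        by (simp add: matrix_vector_mul_assoc SO_transpose_mult[OF hSO] del: transpose_matrix_vector)
      define B where "B = transpose h ** A"
      have BSO: "B \<in> SO" using hSO less.prems by (auto simp: B_def)
      have "j \<in> fixed B"
        using undo[of "axis j 1"] h(3)
        by (simp add: fixed_def B_def matrix_vector_mul_assoc[symmetric] u_def del: transpose_matrix_vector)
      moreover have "fixed A \<subseteq> fixed B"
      proof
        fix i assume i: "i \<in> fixed A"
        then have "h *v axis i 1 = axis i 1" using h(2)[of i] j k0 by auto
        then show "i \<in> fixed B"
          using undo[of "axis i 1"] i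
          by (simp add: fixed_def B_def matrix_vector_mul_assoc[symmetric] del: transpose_matrix_vector)
      qed
      ultimately have "card (- fixed B) < card (- fixed A)"
        using j by (intro psubset_card_mono) auto
      then have "B \<in> G" using less.hyps BSO by blast
      moreover have "A = h ** B"
        by (simp add: B_def matrix_mul_assoc SO_transpose_mult[OF hSO])
      ultimately show ?thesis using mult_G h(1) by simp
    qed
  qed
  then show ?thesis by (simp add: G_def)
qed

section \<open>Differentiability of continuous representations\<close>

lemma norm_mult_orthogonal_matrix:
  fixes M :: "real^'n^'m"
  assumes "orthogonal_matrix g"
  shows "norm (M ** g) = norm M"
proof -
  have "(M ** g) $ r = transpose g *v (M $ r)" for r
    by (simp add: vec_eq_iff matrix_matrix_mult_def vector_matrix_mult_def mult.commute)
  moreover have "orthogonal_transformation ((*v) (transpose g))"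
    using assms by (simp add: orthogonal_transformation_matrix del: transpose_matrix_vector)
  ultimately have "norm ((M ** g) $ r) = norm (M $ r)" for r
    by (metis orthogonal_transformation_norm)
  then show ?thesis by (simp add: norm_vec_def)
qed

lemma transpose_additive:
  fixes A B :: "'a::ab_group_add^'n^'m"
  shows "transpose (A + B) = transpose A + transpose B"
    and "transpose (A - B) = transpose A - transpose B"
    and "transpose (- A) = - transpose A"
    and "transpose (0 :: 'a^'n^'m) = 0"
  by (simp_all add: vec_eq_iff transpose_def)

text \<open>
  Averaging makes a continuous one-parameter group smooth. For small \<open>r\<close> the matrix
  \<open>M = \<integral>\<^sub>0\<^sup>r U\<close> is close to \<open>r\<close> times the identity and hence invertible, while
  \<open>U(t) M = \<integral>\<^sub>t\<^bsup>t+r\<^esup> U\<close> is differentiable in \<open>t\<close> by the fundamental theorem of calculus.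
\<close>

lemma one_parameter_group_differentiable:
  fixes U :: "real \<Rightarrow> complex^'d^'d"
  assumes cont: "continuous_on UNIV U" and add: "\<And>s t. U (s + t) = U s ** U t" and 0: "U 0 = mat 1"
  obtains A where "\<And>t. (U has_vector_derivative A ** U t) (at t)"
proof -
  obtain K where K: "K > 0" "\<And>(A :: complex^'d^'d) x. norm (A *v x) \<le> norm A * norm x * K"
    using bounded_bilinear.pos_bounded[OF bounded_bilinear_matrix_vector_mult] by blast
  have "continuous (at 0) U" using cont by (simp add: continuous_on_eq_continuous_at)
  then obtain d where d: "d > 0" "\<And>s. dist s 0 < d \<Longrightarrow> dist (U s) (U 0) < 1 / (2 * K)"
    unfolding continuous_at_eps_delta using K(1) by (metis zero_less_divide_1_iff zero_less_mult_iff zero_less_numeral)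
  define r where "r = d / 2"
  have r: "r > 0" "\<And>s. s \<in> {0..r} \<Longrightarrow> norm (U s - mat 1) \<le> 1 / (2 * K)"
    using d by (auto simp: r_def dist_norm 0 less_imp_le)
  define M where "M = integral {0..r} U"
  have int: "U integrable_on {a..b}" for a b
    by (intro integrable_continuous_real continuous_on_subset[OF cont]) auto
  have "norm (integral {0..r} (\<lambda>s. U s - mat 1)) \<le> 1 / (2 * K) * (r - 0)"
    using r by (intro integral_bound) (auto intro!: continuous_intros continuous_on_subset[OF cont])
  then have M: "norm (M - r *\<^sub>R mat 1) \<le> r / (2 * K)"
    using r by (simp add: M_def integral_diff[OF int integrable_const_ivl])
  have "x = 0" if "M *v x = 0" for x
  proof -
    have "(M - r *\<^sub>R mat 1) *v x = - (r *\<^sub>R x)"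
      using that by (simp add: matrix_vector_mult_diff_rdistrib
          bounded_bilinear.scaleR_left[OF bounded_bilinear_matrix_vector_mult])
    then have "r * norm x = norm ((M - r *\<^sub>R mat 1) *v x)" using r(1) by simp
    also have "\<dots> \<le> norm (M - r *\<^sub>R mat 1) * norm x * K" by (rule K)
    also have "\<dots> \<le> r / (2 * K) * norm x * K"
      using K(1) by (intro mult_right_mono M) auto
    also have "\<dots> = r * norm x / 2" using K(1) by simp
    finally have "norm x \<le> norm x / 2" using r(1) by simp
    then show "x = 0" by simp
  qed
  then obtain N where "N ** M = mat 1" by (metis matrix_left_invertible_ker)
  then have N: "M ** N = mat 1" by (simp add: matrix_left_right_inverse)
  \<comment> \<open>The lower limit \<open>-1\<close> makes \<open>0\<close> an interior point, so that the derivative at \<open>0\<close> is two-sided.\<close>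
  define G where "G t = integral {-1..t} U" for t
  have G': "(G has_vector_derivative U x) (at x)" if "x > -1" for x
  proof -
    have "((\<lambda>u. integral {-1..u} U) has_vector_derivative U x) (at x within {-1..x + 1})"
      using that by (intro integral_has_vector_derivative continuous_on_subset[OF cont]) auto
    moreover have "at x within {-1..x + 1} = at x"
      using that by (intro at_within_interior) (simp add: interior_atLeastAtMost_real)
    ultimately show ?thesis by (simp add: G_def[abs_def])
  qed
  have U: "U t = (G (t + r) - G t) ** N" if "t \<in> {-1<..<1}" for t
  proof -
    have "U t ** M = integral {0..r} (\<lambda>s. U t ** U s)"
      unfolding M_def
      by (rule integral_linear[OF int bounded_bilinear.bounded_linear_right[OF bounded_bilinear_matrix_mult], symmetric, unfolded o_def])
    also have "\<dots> = integral {0..r} (U \<circ> (\<lambda>s. s + t))"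
      by (simp add: o_def add[symmetric] add.commute)
    also have "\<dots> = integral {0 + t..r + t} U"
      by (rule integral_shift) (rule continuous_on_subset[OF cont], auto)
    also have "\<dots> = G (t + r) - G t"
      using Henstock_Kurzweil_Integration.integral_combine[of "-1" t "t + r" U] that r(1) int by (simp add: G_def algebra_simps)
    finally have "U t ** M ** N = (G (t + r) - G t) ** N" by simp
    then show ?thesis by (simp add: matrix_mul_assoc[symmetric] N)
  qed
  define A where "A = (U r - U 0) ** N"
  have Gr: "((\<lambda>t. G (t + r)) has_vector_derivative U r) (at 0)"
  proof -
    have "((\<lambda>t. t + r) has_vector_derivative 1) (at 0)"
      by (auto intro!: derivative_eq_intros)
    from vector_diff_chain_at[OF this, of G "U r"] G'[of r] r(1) show ?thesis
      by (simp add: o_def)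
  qed
  have "((\<lambda>t. (G (t + r) - G t) ** N) has_vector_derivative A) (at 0)"
    unfolding A_def
    by (intro bounded_linear.has_vector_derivative[OF bounded_bilinear.bounded_linear_left[OF bounded_bilinear_matrix_mult]]
        has_vector_derivative_diff Gr G') auto
  then have U0: "(U has_vector_derivative A) (at 0)"
    by (rule has_vector_derivative_transform_within_open[of _ _ _ "{-1<..<1}"]) (auto simp: U)
  show ?thesis
  proof (rule that)
    fix t
    have "((\<lambda>s. s - t) has_vector_derivative 1) (at t)"
      by (auto intro!: derivative_eq_intros)
    from vector_diff_chain_at[OF this, of U A] U0
    have "((\<lambda>s. U (s - t)) has_vector_derivative A) (at t)" by (simp add: o_def)
    then have "((\<lambda>s. U (s - t) ** U t) has_vector_derivative A ** U t) (at t)"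
      by (rule bounded_linear.has_vector_derivative[OF bounded_bilinear.bounded_linear_left[OF bounded_bilinear_matrix_mult]])
    then show "(U has_vector_derivative A ** U t) (at t)"
      by (simp add: add[symmetric])
  qed
qed

locale SO_representation =
  fixes \<pi> :: "real^'n^'n \<Rightarrow> complex^'d^'d"
  assumes representation: "representation \<pi>"
begin

lemma rep_one [simp]: "\<pi> (mat 1) = mat 1"
  and rep_mult: "A \<in> SO \<Longrightarrow> B \<in> SO \<Longrightarrow> \<pi> (A ** B) = \<pi> A ** \<pi> B"
  and rep_continuous: "continuous_on SO \<pi>"
  using representation by (auto simp: representation_def)

text \<open>
  Let \<open>g\<close> be at distance \<open>a\<close> from the identity. The powers \<open>g\<^sup>j\<close> are at distance at most
  \<open>j a\<close>, so about \<open>r/a\<close> of them stay in a neighbourhood on which \<open>\<pi>\<close> is within \<open>e\<close> of the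
  identity. Telescoping gives \<open>(\<Sum>j<n. \<pi>(g)\<^sup>j) (\<pi>(g) - 1) = \<pi>(g)\<^sup>n - 1\<close>; the sum is
  close to \<open>n\<close> times the identity and the right-hand side is small, so that \<open>\<pi>(g) - 1\<close> is of order
  \<open>1/n\<close>, that is, of order \<open>a\<close>. Working with powers replaces the local logarithm on the group.
\<close>

lemma lipschitz_at_1:
  obtains C r where "r > 0" "\<And>g. g \<in> SO \<Longrightarrow> norm (g - mat 1) < r \<Longrightarrow> norm (\<pi> g - mat 1) \<le> C * norm (g - mat 1)"
proof -
  obtain K where K: "K > 0" "\<And>(A :: complex^'d^'d) (B :: complex^'d^'d). norm (A ** B) \<le> norm A * norm B * K"
    using bounded_bilinear.pos_bounded[OF bounded_bilinear_matrix_mult] by blast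
  \<comment> \<open>The constant \<open>K\<close> bounds matrix multiplication; with this choice an error of norm \<open>n e\<close> in front
    of \<open>D\<close> costs at most half of \<open>n\<close> times the norm of \<open>D\<close> and can be absorbed.\<close>
  define e where "e = 1 / (2 * K)"
  have "e > 0" using K(1) by (simp add: e_def)
  then obtain r where r: "r > 0" "\<And>g. g \<in> SO \<Longrightarrow> norm (g - mat 1) < r \<Longrightarrow> norm (\<pi> g - mat 1) < e"
    using rep_continuous[unfolded continuous_on_iff dist_norm, rule_format, OF SO_1, of e] by auto
  show ?thesis
  proof (rule that[OF r(1)])
    fix g :: "real^'n^'n" assume g: "g \<in> SO" "norm (g - mat 1) < r"
    define a where "a = norm (g - mat 1)"
    define D where "D = \<pi> g - mat 1"
    show "norm (\<pi> g - mat 1) \<le> 4 * e / r * norm (g - mat 1)"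
    proof (cases "a = 0")
      case True
      then have "g = mat 1" by (simp add: a_def)
      then show ?thesis by simp
    next
      case False
      then have a: "a > 0" "a < r" using g by (auto simp: a_def)
      \<comment> \<open>The largest \<open>n\<close> with \<open>n a < r\<close>.\<close>
      define n where "n = nat (\<lceil>r / a\<rceil> - 1)"
      have "r / a > 1" using a by simp
      then have n: "real n < r / a" "r / a \<le> real n + 1" "n \<ge> 1"
        unfolding n_def by linarith+
      have na: "real n * a < r" "r \<le> 2 * (real n * a)"
      proof -
        show "real n * a < r" using n(1) a by (simp add: field_simps)
        have "r \<le> (real n + 1) * a" using n(2) a by (simp add: field_simps)
        also have "\<dots> \<le> (2 * real n) * a" using n(3) a by (intro mult_right_mono) auto
        finally show "r \<le> 2 * (real n * a)" by simp
      qed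
      define p where "p j = ((\<lambda>A. A ** g) ^^ j) (mat 1)" for j
      have p: "p 0 = mat 1" "p (Suc j) = p j ** g" for j by (simp_all add: p_def)
      have pSO: "p j \<in> SO" for j by (induction j) (use g in \<open>auto simp: p\<close>)
      have "norm (p j - mat 1) \<le> real j * a" for j
      proof (induction j)
        case (Suc j)
        have "p (Suc j) - mat 1 = (p j - mat 1) ** g + (g - mat 1)"
          by (simp add: p matrix_mult_simps)
        also have "norm \<dots> \<le> norm ((p j - mat 1) ** g) + norm (g - mat 1)"
          by (rule norm_triangle_ineq)
        also have "\<dots> \<le> real j * a + a"
          using Suc g by (simp add: norm_mult_orthogonal_matrix SO_iff a_def)
        finally show ?case by (simp add: algebra_simps)
      qed (simp add: p)
      then have "norm (p j - mat 1) < r" if "j \<le> n" for j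
      proof -
        have "real j * a \<le> real n * a" using that a(1) by (intro mult_right_mono) auto
        then show ?thesis using na(1) \<open>norm (p j - mat 1) \<le> real j * a\<close> by simp
      qed
      then have small: "norm (\<pi> (p j) - mat 1) \<le> e" if "j \<le> n" for j
        using r(2)[OF pSO, of j] that by (simp add: less_imp_le)
      define S where "S k = (\<Sum>j<k. \<pi> (p j))" for k
      have tele: "S k ** D = \<pi> (p k) - mat 1" for k
      proof (induction k)
        case (Suc k)
        have "S (Suc k) ** D = S k ** D + \<pi> (p k) ** D"
          by (simp add: S_def matrix_mult_simps)
        also have "\<dots> = \<pi> (p k) - mat 1 + (\<pi> (p k) ** \<pi> g - \<pi> (p k))"
          unfolding Suc by (simp add: D_def matrix_mult_simps)
        finally show ?case by (simp add: p rep_mult pSO g)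
      qed (simp add: S_def p matrix_mult_simps)
      have "norm (real n *\<^sub>R mat 1 - S n) = norm (\<Sum>j<n. mat 1 - \<pi> (p j))"
        by (simp add: S_def sum_subtractf sum_constant_scaleR del: sum_constant)
      also have "\<dots> \<le> of_nat (card {..<n}) * e"
        by (rule sum_norm_bound) (use small in \<open>auto simp: norm_minus_commute\<close>)
      finally have S: "norm (real n *\<^sub>R mat 1 - S n) \<le> real n * e" by simp
      have "real n *\<^sub>R D = S n ** D + (real n *\<^sub>R mat 1 - S n) ** D"
        by (simp add: matrix_mult_simps)
      then have "real n * norm D = norm (S n ** D + (real n *\<^sub>R mat 1 - S n) ** D)"
        using norm_scaleR[of "real n" D] by simp
      also have "\<dots> \<le> norm (S n ** D) + norm ((real n *\<^sub>R mat 1 - S n) ** D)"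
        by (rule norm_triangle_ineq)
      also have "\<dots> \<le> e + norm (real n *\<^sub>R mat 1 - S n) * norm D * K"
        using small[of n] K(2) by (intro add_mono) (auto simp: tele)
      also have "\<dots> \<le> e + real n * e * norm D * K"
        using S K(1) by (intro add_mono mult_right_mono) auto
      also have "\<dots> = e + real n * norm D / 2" using K(1) by (simp add: e_def)
      finally have "real n * norm D \<le> 2 * e" by simp
      then have "a * (real n * norm D) \<le> a * (2 * e)"
        using a(1) by (intro mult_left_mono) auto
      moreover have "r * norm D \<le> 2 * (real n * a) * norm D"
        using na(2) by (intro mult_right_mono) auto
      ultimately have "r * norm D \<le> 4 * e * a" by (simp add: algebra_simps)
      then show ?thesis using r(1) by (simp add: D_def a_def field_simps)
    qed
  qed
qed

lemma mexp_has_vector_derivative_differential: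
  assumes "transpose X = - X"
  shows "((\<lambda>t. \<pi> (mexp (t *\<^sub>R X))) has_vector_derivative differential \<pi> X ** \<pi> (mexp (t *\<^sub>R X))) (at t)"
proof -
  have "continuous_on UNIV (\<lambda>t. \<pi> (mexp (t *\<^sub>R X)))"
    by (rule continuous_on_compose2[OF rep_continuous continuous_on_mexp[of _ X]]) (use mexp_skew_SO[OF assms] in auto)
  moreover have "\<pi> (mexp ((s + t) *\<^sub>R X)) = \<pi> (mexp (s *\<^sub>R X)) ** \<pi> (mexp (t *\<^sub>R X))" for s t
    unfolding mexp_add by (intro rep_mult mexp_skew_SO assms)
  ultimately obtain A where A: "\<And>t. ((\<lambda>t. \<pi> (mexp (t *\<^sub>R X))) has_vector_derivative A ** \<pi> (mexp (t *\<^sub>R X))) (at t)"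
    by (rule one_parameter_group_differentiable[of "\<lambda>t. \<pi> (mexp (t *\<^sub>R X))"]) auto
  have "differential \<pi> X = A"
    using vector_derivative_at[OF A[of 0]] by (simp add: differential_def matrix_exp_eq_mexp)
  then show ?thesis using A by simp
qed

lemma mexp_has_vector_derivative_at_0:
  assumes "transpose X = - X"
  shows "((\<lambda>t. \<pi> (mexp (t *\<^sub>R X))) has_vector_derivative differential \<pi> X) (at 0)"
  using mexp_has_vector_derivative_differential[OF assms, of 0] by simp

text \<open>
  The curve \<open>\<delta>(t) = exp(-tX) \<gamma>(t)\<close> has derivative \<open>0\<close> at \<open>0\<close>. By the Lipschitz estimate the
  same holds for its image under \<open>\<pi>\<close>, so \<open>\<pi>(\<gamma>(t)) = \<pi>(exp(tX)) \<pi>(\<delta>(t))\<close> has the same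
  derivative as \<open>\<pi>(exp(tX))\<close>.
\<close>

lemma curve_has_vector_derivative:
  assumes SO: "\<And>t. \<gamma> t \<in> SO" and 0: "\<gamma> 0 = mat 1"
    and deriv: "(\<gamma> has_vector_derivative X) (at 0)" and X: "transpose X = - X"
  shows "((\<lambda>t. \<pi> (\<gamma> t)) has_vector_derivative differential \<pi> X) (at 0)"
proof -
  define \<delta> where "\<delta> t = mexp (- t *\<^sub>R X) ** \<gamma> t" for t
  have \<delta>SO: "\<delta> t \<in> SO" for t
    unfolding \<delta>_def by (intro SO_mult mexp_skew_SO X SO)
  have \<delta>0: "\<delta> 0 = mat 1" by (simp add: \<delta>_def 0)
  have \<delta>': "(\<delta> has_vector_derivative 0) (at 0)"
    using matrix_mult_has_vector_derivative[OF mexp_minus_has_vector_derivative[of X 0] deriv]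
    by (simp add: \<delta>_def[abs_def] 0)
  obtain C r where Cr: "r > 0"
      "\<And>g. g \<in> SO \<Longrightarrow> norm (g - mat 1) < r \<Longrightarrow> norm (\<pi> g - mat 1) \<le> C * norm (g - mat 1)"
    by (rule lipschitz_at_1) blast
  have "(\<delta> \<longlongrightarrow> mat 1) (at 0)"
    using has_vector_derivative_continuous[OF \<delta>'] by (simp add: isCont_def \<delta>0)
  then have ev: "\<forall>\<^sub>F t in at 0. norm (\<delta> t - mat 1) < r"
    using Cr(1) by (simp add: tendsto_iff dist_norm)
  have lim: "((\<lambda>t. (1 / norm (t - 0)) *\<^sub>R (\<delta> t - mat 1)) \<longlongrightarrow> 0) (at 0)"
    using \<delta>' by (simp add: has_vector_derivative_def has_derivative_within \<delta>0)
  have "((\<lambda>t. (1 / norm (t - 0)) *\<^sub>R (\<pi> (\<delta> t) - mat 1)) \<longlongrightarrow> 0) (at 0)"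
  proof (rule Lim_null_comparison)
    show "\<forall>\<^sub>F t in at 0. norm ((1 / norm (t - 0)) *\<^sub>R (\<pi> (\<delta> t) - mat 1))
        \<le> C * norm ((1 / norm (t - 0)) *\<^sub>R (\<delta> t - mat 1))"
      using ev
    proof eventually_elim
      case (elim t)
      have "1 / \<bar>t\<bar> * norm (\<pi> (\<delta> t) - mat 1) \<le> 1 / \<bar>t\<bar> * (C * norm (\<delta> t - mat 1))"
        by (intro mult_left_mono Cr(2) \<delta>SO elim) auto
      then show ?case by (simp add: mult.left_commute)
    qed
    show "((\<lambda>t. C * norm ((1 / norm (t - 0)) *\<^sub>R (\<delta> t - mat 1))) \<longlongrightarrow> 0) (at 0)"
      using tendsto_mult_right_zero[OF tendsto_norm_zero[OF lim]] .
  qed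
  then have "((\<lambda>t. \<pi> (\<delta> t)) has_vector_derivative 0) (at 0)"
    by (simp add: has_vector_derivative_def has_derivative_within \<delta>0)
  from matrix_mult_has_vector_derivative[OF mexp_has_vector_derivative_at_0[OF X] this]
  have "((\<lambda>t. \<pi> (mexp (t *\<^sub>R X)) ** \<pi> (\<delta> t)) has_vector_derivative differential \<pi> X) (at 0)"
    by (simp add: \<delta>0)
  moreover have "\<pi> (mexp (t *\<^sub>R X)) ** \<pi> (\<delta> t) = \<pi> (\<gamma> t)" for t
  proof -
    have "mexp (t *\<^sub>R X) ** \<delta> t = \<gamma> t"
      by (simp only: \<delta>_def matrix_mul_assoc mexp_minus_right matrix_mul_lid)
    then show ?thesis using rep_mult[OF mexp_skew_SO[OF X, of t] \<delta>SO[of t]] by simp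
  qed
  ultimately show ?thesis by simp
qed

lemma differential_eqI:
  assumes "\<And>t. \<gamma> t \<in> SO" "\<gamma> 0 = mat 1" "(\<gamma> has_vector_derivative X) (at 0)" "transpose X = - X"
    and "((\<lambda>t. \<pi> (\<gamma> t)) has_vector_derivative D) (at 0)"
  shows "differential \<pi> X = D"
  using vector_derivative_unique_at[OF curve_has_vector_derivative[OF assms(1-4)] assms(5)] .

text \<open>
  The curve \<open>exp(tX) exp(tY)\<close> has tangent \<open>X + Y\<close> at the identity.
\<close>

lemma differential_add:
  assumes "transpose X = - X" "transpose Y = - Y"
  shows "differential \<pi> (X + Y) = differential \<pi> X + differential \<pi> Y"
proof (rule differential_eqI)
  show "mexp (t *\<^sub>R X) ** mexp (t *\<^sub>R Y) \<in> SO" for t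
    by (intro SO_mult mexp_skew_SO assms)
  show "((\<lambda>t. mexp (t *\<^sub>R X) ** mexp (t *\<^sub>R Y)) has_vector_derivative X + Y) (at 0)"
    using matrix_mult_has_vector_derivative[OF mexp_has_vector_derivative[of X 0] mexp_has_vector_derivative[of Y 0]]
    by (simp add: add.commute)
  show "transpose (X + Y) = - (X + Y)"
    by (simp add: transpose_additive assms)
  show "((\<lambda>t. \<pi> (mexp (t *\<^sub>R X) ** mexp (t *\<^sub>R Y))) has_vector_derivative
      differential \<pi> X + differential \<pi> Y) (at 0)"
    using matrix_mult_has_vector_derivative[OF mexp_has_vector_derivative_at_0[OF assms(1)]
        mexp_has_vector_derivative_at_0[OF assms(2)]]
    by (simp add: rep_mult mexp_skew_SO assms add.commute)
qed simp

lemma differential_scaleR: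
  assumes "transpose X = - X"
  shows "differential \<pi> (c *\<^sub>R X) = c *\<^sub>R differential \<pi> X"
proof (rule differential_eqI)
  have c: "((\<lambda>t. t * c) has_vector_derivative c) (at 0)"
    by (auto intro!: derivative_eq_intros)
  show "mexp ((t * c) *\<^sub>R X) \<in> SO" for t
    by (intro mexp_skew_SO assms)
  show "((\<lambda>t. mexp ((t * c) *\<^sub>R X)) has_vector_derivative c *\<^sub>R X) (at 0)"
    using vector_diff_chain_at[OF c, of "\<lambda>t. mexp (t *\<^sub>R X)" X] mexp_has_vector_derivative[of X 0]
    by (simp add: o_def)
  show "transpose (c *\<^sub>R X) = - (c *\<^sub>R X)"
    using assms by (simp add: transpose_scalar)
  show "((\<lambda>t. \<pi> (mexp ((t * c) *\<^sub>R X))) has_vector_derivative c *\<^sub>R differential \<pi> X) (at 0)"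
    using vector_diff_chain_at[OF c, of "\<lambda>t. \<pi> (mexp (t *\<^sub>R X))"] mexp_has_vector_derivative_at_0[OF assms]
    by (simp add: o_def)
qed simp

lemma differential_conjugate:
  assumes g: "g \<in> SO" and X: "transpose X = - X"
  shows "differential \<pi> (g ** X ** transpose g) = \<pi> g ** differential \<pi> X ** \<pi> (transpose g)"
proof (rule differential_eqI)
  show "g ** mexp (t *\<^sub>R X) ** transpose g \<in> SO" for t
    by (intro SO_mult SO_transpose mexp_skew_SO g X)
  show "g ** mexp (0 *\<^sub>R X) ** transpose g = mat 1"
    by (simp add: SO_transpose_mult[OF g])
  show "((\<lambda>t. g ** mexp (t *\<^sub>R X) ** transpose g) has_vector_derivative g ** X ** transpose g) (at 0)"
    using bounded_linear.has_vector_derivative[OF bounded_linear_matrix_mult_both mexp_has_vector_derivative[of X 0], of g "transpose g"] by simp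
  show "transpose (g ** X ** transpose g) = - (g ** X ** transpose g)"
    by (simp add: matrix_transpose_mul X matrix_mult_simps matrix_mul_assoc)
  show "((\<lambda>t. \<pi> (g ** mexp (t *\<^sub>R X) ** transpose g)) has_vector_derivative
      \<pi> g ** differential \<pi> X ** \<pi> (transpose g)) (at 0)"
    using bounded_linear.has_vector_derivative[OF bounded_linear_matrix_mult_both mexp_has_vector_derivative_at_0[OF X], of "\<pi> g" "\<pi> (transpose g)"]
    by (simp add: rep_mult SO_mult SO_transpose mexp_skew_SO g X)
qed

lemma differential_minus:
  assumes "transpose X = - X"
  shows "differential \<pi> (- X) = - differential \<pi> X"
  using differential_scaleR[OF assms, of "-1"] by simp

lemma differential_0 [simp]: "differential \<pi> 0 = 0"
  using differential_scaleR[of 0 0] by (simp add: transpose_additive)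

text \<open>
  Differentiate \<open>d\<pi>(exp(sX) Y exp(-sX)) = \<pi>(exp(sX)) d\<pi>(Y) \<pi>(exp(-sX))\<close> at \<open>s = 0\<close>.
\<close>

lemma differential_bracket:
  assumes X: "transpose X = - X" and Y: "transpose Y = - Y"
  shows "differential \<pi> (X ** Y - Y ** X)
       = differential \<pi> X ** differential \<pi> Y - differential \<pi> Y ** differential \<pi> X"
proof -
  \<comment> \<open>The differential is linear only on skew-symmetric matrices. Composing it with the projection
    onto them gives a linear map on all matrices, which can be differentiated along curves.\<close>
  define S where "S Z = (1 / 2) *\<^sub>R (Z - transpose Z)" for Z :: "real^'n^'n"
  have S_skew: "transpose (S Z) = - S Z" for Z
    by (simp add: S_def transpose_scalar transpose_additive scaleR_diff_right)
  have S_eq: "S Z = Z" if "transpose Z = - Z" for Z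
    unfolding S_def that by (simp add: vec_eq_iff)
  have S_add: "S (Z + Z') = S Z + S Z'" for Z Z'
    by (simp add: S_def vec_eq_iff transpose_def field_simps)
  have S_scale: "S (c *\<^sub>R Z) = c *\<^sub>R S Z" for c Z
    by (simp add: S_def vec_eq_iff transpose_def field_simps)
  have "linear (\<lambda>Z. differential \<pi> (S Z))"
    by (rule linearI) (simp_all add: S_add S_scale differential_add differential_scaleR S_skew)
  then have bl: "bounded_linear (\<lambda>Z. differential \<pi> (S Z))"
    by (simp add: linear_conv_bounded_linear)
  define c where "c s = mexp (s *\<^sub>R X) ** Y ** mexp (s *\<^sub>R (- X))" for s
  have X': "transpose (- X) = - (- X)" by (simp add: transpose_additive X)
  have inv: "transpose (mexp (s *\<^sub>R X)) = mexp (s *\<^sub>R (- X))" for s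
  proof -
    have "transpose (mexp (s *\<^sub>R X)) = transpose (mexp (s *\<^sub>R X)) ** (mexp (s *\<^sub>R X) ** mexp (- s *\<^sub>R X))"
      by (simp only: mexp_minus_right matrix_mul_rid)
    also have "\<dots> = mexp (- s *\<^sub>R X)"
      by (simp only: matrix_mul_assoc SO_transpose_mult[OF mexp_skew_SO[OF X]] matrix_mul_lid)
    finally show ?thesis by simp
  qed
  have c': "(c has_vector_derivative X ** Y - Y ** X) (at 0)"
  proof -
    have "((\<lambda>s. mexp (s *\<^sub>R X) ** Y) has_vector_derivative X ** Y) (at 0)"
      using bounded_linear.has_vector_derivative[OF bounded_bilinear.bounded_linear_left[OF bounded_bilinear_matrix_mult]
          mexp_has_vector_derivative[of X 0]] by simp
    from matrix_mult_has_vector_derivative[OF this mexp_has_vector_derivative[of "- X" 0]]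
    show ?thesis by (simp add: c_def[abs_def] matrix_mult_simps)
  qed
  have c_skew: "transpose (c s) = - c s" for s
    unfolding c_def inv[symmetric]
    by (simp add: matrix_transpose_mul Y matrix_mult_simps matrix_mul_assoc)
  have br_skew: "transpose (X ** Y - Y ** X) = - (X ** Y - Y ** X)"
    by (simp add: transpose_additive matrix_transpose_mul X Y matrix_mult_simps)
  have "((\<lambda>s. differential \<pi> (S (c s))) has_vector_derivative differential \<pi> (S (X ** Y - Y ** X))) (at 0)"
    by (rule bounded_linear.has_vector_derivative[OF bl c'])
  then have *: "((\<lambda>s. differential \<pi> (c s)) has_vector_derivative differential \<pi> (X ** Y - Y ** X)) (at 0)"
    by (simp add: S_eq c_skew br_skew)
  have "differential \<pi> (c s) = \<pi> (mexp (s *\<^sub>R X)) ** differential \<pi> Y ** \<pi> (mexp (s *\<^sub>R (- X)))" for s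
    unfolding c_def inv[symmetric] by (intro differential_conjugate mexp_skew_SO X Y)
  moreover have "((\<lambda>s. \<pi> (mexp (s *\<^sub>R X)) ** differential \<pi> Y ** \<pi> (mexp (s *\<^sub>R (- X)))) has_vector_derivative
      differential \<pi> X ** differential \<pi> Y - differential \<pi> Y ** differential \<pi> X) (at 0)"
  proof -
    have "((\<lambda>s. \<pi> (mexp (s *\<^sub>R X)) ** differential \<pi> Y) has_vector_derivative differential \<pi> X ** differential \<pi> Y) (at 0)"
      by (rule bounded_linear.has_vector_derivative[OF bounded_bilinear.bounded_linear_left[OF bounded_bilinear_matrix_mult]
          mexp_has_vector_derivative_at_0[OF X]])
    from matrix_mult_has_vector_derivative[OF this mexp_has_vector_derivative_at_0[OF X']]
    show ?thesis by (simp add: differential_minus X matrix_mult_simps)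
  qed
  ultimately show ?thesis
    using vector_derivative_unique_at[OF *] by simp
qed

end

section \<open>The derived representation of the complexified Lie algebra\<close>

lemma matrix_scale_mult:
  "matrix_scale c A ** B = matrix_scale c (A ** B)"
  "A ** matrix_scale c B = matrix_scale c (A ** B)"
  by (simp_all add: matrix_scale_def vec_eq_iff matrix_matrix_mult_def sum_distrib_left mult.assoc mult.left_commute)

lemma matrix_scale_vector: "matrix_scale c A *v x = c *s (A *v x)"
  by (simp add: matrix_scale_def vec_eq_iff matrix_vector_mult_def sum_distrib_left mult.assoc)

lemma matrix_scale_simps:
  "matrix_scale c (A + B) = matrix_scale c A + matrix_scale c B"
  "matrix_scale c (A - B) = matrix_scale c A - matrix_scale c B"
  "matrix_scale c (- A) = - matrix_scale c A"
  "matrix_scale c 0 = 0"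
  "matrix_scale c (matrix_scale d A) = matrix_scale (c * d) A"
  "matrix_scale (-1) A = - A"
  "matrix_scale 1 A = A"
  by (simp_all add: matrix_scale_def vec_eq_iff algebra_simps)

definition re_matrix :: "complex^'n^'m \<Rightarrow> real^'n^'m" where
  "re_matrix X = (\<chi> r s. Re (X $ r $ s))"

definition im_matrix :: "complex^'n^'m \<Rightarrow> real^'n^'m" where
  "im_matrix X = (\<chi> r s. Im (X $ r $ s))"

definition complex_matrix :: "real^'n^'m \<Rightarrow> complex^'n^'m" where
  "complex_matrix X = (\<chi> r s. complex_of_real (X $ r $ s))"

lemma differential_complex_eq:
  "differential_complex \<pi> X = differential \<pi> (re_matrix X) + matrix_scale \<i> (differential \<pi> (im_matrix X))"
  by (simp add: differential_complex_def re_matrix_def im_matrix_def)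

lemma re_im_matrix_simps:
  "re_matrix (X + Y) = re_matrix X + re_matrix Y"
  "im_matrix (X + Y) = im_matrix X + im_matrix Y"
  "re_matrix (X - Y) = re_matrix X - re_matrix Y"
  "im_matrix (X - Y) = im_matrix X - im_matrix Y"
  "re_matrix (A ** B) = re_matrix A ** re_matrix B - im_matrix A ** im_matrix B"
  "im_matrix (A ** B) = re_matrix A ** im_matrix B + im_matrix A ** re_matrix B"
  "re_matrix (matrix_scale c X) = Re c *\<^sub>R re_matrix X - Im c *\<^sub>R im_matrix X"
  "im_matrix (matrix_scale c X) = Re c *\<^sub>R im_matrix X + Im c *\<^sub>R re_matrix X"
  "re_matrix (complex_matrix Z) = Z"
  "im_matrix (complex_matrix Z) = 0"
  by (simp_all add: re_matrix_def im_matrix_def complex_matrix_def matrix_scale_def vec_eq_iff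
      matrix_matrix_mult_def sum_subtractf sum.distrib)

lemma so_complex_parts:
  assumes "X \<in> so_complex"
  shows "transpose (re_matrix X) = - re_matrix X" "transpose (im_matrix X) = - im_matrix X"
proof -
  have "transpose (re_matrix X) = re_matrix (transpose X)" "transpose (im_matrix X) = im_matrix (transpose X)"
    by (simp_all add: re_matrix_def im_matrix_def transpose_def vec_eq_iff)
  moreover have "transpose X = - X" using assms by (simp add: so_complex_def)
  ultimately show "transpose (re_matrix X) = - re_matrix X" "transpose (im_matrix X) = - im_matrix X"
    by (simp_all add: re_matrix_def im_matrix_def vec_eq_iff)
qed

lemma complex_matrix_so_complex:
  assumes "transpose X = - X"
  shows "complex_matrix X \<in> so_complex"
proof -
  have "transpose (complex_matrix X) = complex_matrix (transpose X)"
    by (simp add: complex_matrix_def transpose_def vec_eq_iff)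
  also have "\<dots> = - complex_matrix X"
    unfolding assms by (simp add: complex_matrix_def vec_eq_iff)
  finally show ?thesis by (simp add: so_complex_def)
qed

lemma transpose_matrix_scale: "transpose (matrix_scale c X) = matrix_scale c (transpose X)"
  by (simp add: matrix_scale_def transpose_def vec_eq_iff)

lemma so_complex_scale: "X \<in> so_complex \<Longrightarrow> matrix_scale c X \<in> so_complex"
  by (simp add: so_complex_def transpose_matrix_scale matrix_scale_simps)

lemma so_complex_add: "X \<in> so_complex \<Longrightarrow> Y \<in> so_complex \<Longrightarrow> X + Y \<in> so_complex"
  by (simp add: so_complex_def transpose_additive)

lemma so_complex_lie_bracket: "X \<in> so_complex \<Longrightarrow> Y \<in> so_complex \<Longrightarrow> lie_bracket X Y \<in> so_complex"
  by (simp add: so_complex_def lie_bracket_def transpose_additive matrix_transpose_mul matrix_mult_simps)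

lemmas so_complex_closed = so_complex_add so_complex_scale so_complex_lie_bracket

text \<open>
  The partial sums of the exponential series map the subspace into itself, and finite-dimensional
  subspaces are closed.
\<close>

lemma mexp_subspace:
  fixes A :: "complex^'d^'d"
  assumes W: "vec.subspace W" and inv: "\<And>w. w \<in> W \<Longrightarrow> A *v w \<in> W" and w: "w \<in> W"
  shows "mexp A *v w \<in> W"
proof -
  have scaleR: "c *\<^sub>R u = complex_of_real c *s u" for c and u :: "complex^'d"
    by (vector complex_eq_iff)
  have sub: "subspace W"
    by (rule subspaceI)
       (simp_all only: scaleR vec.subspace_0[OF W] vec.subspace_add[OF W] vec.subspace_scale[OF W])
  have bl: "bounded_linear (\<lambda>M. M *v w)" for w :: "complex^'d"
    using bounded_bilinear.bounded_linear_left[OF bounded_bilinear_matrix_vector_mult] .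
  have pow: "((**) A ^^ k) (mat 1) *v w \<in> W" for k
  proof (induction k)
    case (Suc k)
    have "((**) A ^^ Suc k) (mat 1) *v w = A *v (((**) A ^^ k) (mat 1) *v w)"
      by (simp add: matrix_vector_mul_assoc)
    then show ?case using inv[OF Suc] by simp
  qed (simp add: w)
  have "(\<lambda>n. \<Sum>k<n. ((1 / fact k) *\<^sub>R ((**) A ^^ k) (mat 1)) *v w) \<longlonglongrightarrow> mexp A *v w"
    using bounded_linear.sums[OF bl summable_sums[OF summable_mexp[of A]]]
    by (simp add: sums_def mexp_def)
  moreover have "(\<Sum>k<n. ((1 / fact k) *\<^sub>R ((**) A ^^ k) (mat 1)) *v w) \<in> W" for n
    unfolding bounded_bilinear.scaleR_left[OF bounded_bilinear_matrix_vector_mult]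
    by (intro subspace_sum sub subspace_scale pow)
  ultimately show ?thesis
    by (rule closed_sequentially[OF closed_subspace[OF sub], rotated])
qed

context SO_representation
begin

lemma mexp_differential:
  assumes "transpose X = - X"
  shows "\<pi> (mexp X) = mexp (differential \<pi> X)"
  using mexp_ode_unique[of "\<lambda>t. \<pi> (mexp (t *\<^sub>R X))", OF mexp_has_vector_derivative_differential[OF assms], of 1]
  by simp

lemma differential_complex_add:
  assumes "X \<in> so_complex" "Y \<in> so_complex"
  shows "differential_complex \<pi> (X + Y) = differential_complex \<pi> X + differential_complex \<pi> Y"
  unfolding differential_complex_eq re_im_matrix_simps
  by (simp add: differential_add so_complex_parts assms matrix_scale_simps)

lemma differential_combination:
  assumes "transpose X = - X" "transpose Y = - Y"
  shows "differential \<pi> (a *\<^sub>R X + b *\<^sub>R Y) = a *\<^sub>R differential \<pi> X + b *\<^sub>R differential \<pi> Y"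
  by (subst differential_add) (simp_all add: differential_scaleR transpose_scalar assms)

lemma differential_complex_scale:
  assumes "X \<in> so_complex"
  shows "differential_complex \<pi> (matrix_scale c X) = matrix_scale c (differential_complex \<pi> X)"
proof -
  have "re_matrix (matrix_scale c X) = Re c *\<^sub>R re_matrix X + (- Im c) *\<^sub>R im_matrix X"
    by (simp add: re_im_matrix_simps)
  then show ?thesis
    unfolding differential_complex_eq re_im_matrix_simps(8)
    by (simp only: differential_combination so_complex_parts[OF assms])
       (simp add: vec_eq_iff matrix_scale_def complex_eq_iff algebra_simps)
qed

lemma differential_complex_bracket:
  assumes "X \<in> so_complex" "Y \<in> so_complex"
  shows "differential_complex \<pi> (lie_bracket X Y)
       = lie_bracket (differential_complex \<pi> X) (differential_complex \<pi> Y)"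
proof -
  define A B C E where ABCE: "A = re_matrix X" "B = re_matrix Y" "C = im_matrix X" "E = im_matrix Y"
  have sk: "transpose A = - A" "transpose B = - B" "transpose C = - C" "transpose E = - E"
    using assms by (simp_all add: ABCE so_complex_parts)
  have br_skew: "transpose (M ** N - N ** M) = - (M ** N - N ** M)"
    if "transpose M = - M" "transpose N = - N" for M N :: "real^'n^'n"
    by (simp add: transpose_additive matrix_transpose_mul that matrix_mult_simps)
  have re: "re_matrix (lie_bracket X Y) = 1 *\<^sub>R (A ** B - B ** A) + (-1) *\<^sub>R (C ** E - E ** C)"
    by (simp add: lie_bracket_def re_im_matrix_simps ABCE)
  have im: "im_matrix (lie_bracket X Y) = (A ** E - E ** A) + (C ** B - B ** C)"
    by (simp add: lie_bracket_def re_im_matrix_simps ABCE)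
  have "differential_complex \<pi> (lie_bracket X Y) =
      (differential \<pi> (A ** B - B ** A) - differential \<pi> (C ** E - E ** C))
      + matrix_scale \<i> (differential \<pi> (A ** E - E ** A) + differential \<pi> (C ** B - B ** C))"
    unfolding differential_complex_eq re im
    by (simp only: differential_combination differential_add br_skew sk) simp
  then show ?thesis
    unfolding differential_complex_eq[of \<pi> X] differential_complex_eq[of \<pi> Y] ABCE[symmetric]
    by (simp add: differential_bracket sk lie_bracket_def matrix_mult_simps matrix_scale_mult matrix_scale_simps)
qed

lemma differential_complex_of_real:
  "differential_complex \<pi> (complex_matrix X) = differential \<pi> X"
  by (simp add: differential_complex_eq re_im_matrix_simps matrix_scale_simps)

text \<open>
  By generation it suffices to treat an exponential, where \<open>\<pi>(exp X) = exp(d\<pi>(X))\<close>.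
\<close>

lemma subspace_invariant:
  assumes W: "vec.subspace W"
    and inv: "\<And>X w. X \<in> so_complex \<Longrightarrow> w \<in> W \<Longrightarrow> differential_complex \<pi> X *v w \<in> W"
    and "k \<in> SO" "w \<in> W"
  shows "\<pi> k *v w \<in> W"
  using \<open>k \<in> SO\<close> \<open>w \<in> W\<close>
proof (induction k arbitrary: w rule: SO_induct)
  case (mexp X)
  have "differential \<pi> X *v u \<in> W" if "u \<in> W" for u
    using inv[OF complex_matrix_so_complex[OF mexp.hyps] that] by (simp add: differential_complex_of_real)
  then show ?case
    unfolding mexp_differential[OF mexp.hyps] using mexp_subspace[OF W] mexp.prems by blast
next
  case (mult A B)
  then show ?case by (simp add: rep_mult matrix_vector_mul_assoc[symmetric])
qed

end

text \<open>
  Along \<open>exp(tX)\<close>, the function \<open>T \<pi>(exp(tX))\<close> solves \<open>F' = d\<rho>(X) F\<close> with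
  \<open>F(0) = T\<close>, as \<open>\<rho>(exp(tX)) T\<close> does.
\<close>

lemma intertwiner_of_differential:
  assumes "SO_representation \<pi>" "SO_representation \<rho>"
    and T: "\<And>X. X \<in> so_complex \<Longrightarrow> T ** differential_complex \<pi> X = differential_complex \<rho> X ** T"
    and "k \<in> SO"
  shows "T ** \<pi> k = \<rho> k ** T"
proof -
  interpret \<pi>: SO_representation \<pi> by fact
  interpret \<rho>: SO_representation \<rho> by fact
  show ?thesis using \<open>k \<in> SO\<close>
  proof (induction k rule: SO_induct)
    case (mexp X)
    define F where "F t = T ** \<pi> (mexp (t *\<^sub>R X))" for t
    have "(F has_vector_derivative differential \<rho> X ** F t) (at t)" for t
    proof -
      have "(F has_vector_derivative T ** (differential \<pi> X ** \<pi> (mexp (t *\<^sub>R X)))) (at t)"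
        unfolding F_def
        by (rule bounded_linear.has_vector_derivative[OF bounded_bilinear.bounded_linear_right[OF bounded_bilinear_matrix_mult]
              \<pi>.mexp_has_vector_derivative_differential[OF mexp]])
      moreover have "T ** differential \<pi> X = differential \<rho> X ** T"
        using T[OF complex_matrix_so_complex[OF mexp]]
        by (simp add: \<pi>.differential_complex_of_real \<rho>.differential_complex_of_real)
      ultimately show ?thesis by (simp add: F_def matrix_mul_assoc)
    qed
    from mexp_ode_unique[OF this, of 1] show ?case
      by (simp add: F_def \<rho>.mexp_differential[OF mexp])
  next
    case (mult A B)
    then show ?case
      by (metis \<pi>.rep_mult \<rho>.rep_mult matrix_mul_assoc)
  qed
qed

lemma differential_of_intertwiner:
  assumes "SO_representation \<pi>" "SO_representation \<rho>"
    and T: "\<And>k. k \<in> SO \<Longrightarrow> T ** \<pi> k = \<rho> k ** T"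
    and "X \<in> so_complex"
  shows "T ** differential_complex \<pi> X = differential_complex \<rho> X ** T"
proof -
  interpret \<pi>: SO_representation \<pi> by fact
  interpret \<rho>: SO_representation \<rho> by fact
  have real: "T ** differential \<pi> X = differential \<rho> X ** T" if X: "transpose X = - X" for X
  proof -
    have "((\<lambda>t. T ** \<pi> (mexp (t *\<^sub>R X))) has_vector_derivative T ** differential \<pi> X) (at 0)"
      by (rule bounded_linear.has_vector_derivative[OF bounded_bilinear.bounded_linear_right[OF bounded_bilinear_matrix_mult]
            \<pi>.mexp_has_vector_derivative_at_0[OF X]])
    moreover have "((\<lambda>t. \<rho> (mexp (t *\<^sub>R X)) ** T) has_vector_derivative differential \<rho> X ** T) (at 0)"
      by (rule bounded_linear.has_vector_derivative[OF bounded_bilinear.bounded_linear_left[OF bounded_bilinear_matrix_mult]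
            \<rho>.mexp_has_vector_derivative_at_0[OF X]])
    ultimately show ?thesis
      by (simp add: T mexp_skew_SO[OF X] vector_derivative_unique_at)
  qed
  show ?thesis
    unfolding differential_complex_eq
    by (simp add: matrix_mult_simps matrix_scale_mult real so_complex_parts assms)
qed

lemma reflection_involution [simp]: "reflection l idx ** reflection l idx = mat 1"
proof -
  have "(reflection l idx ** reflection l idx) $ r $ s = (\<Sum>k\<in>UNIV. if k = r then (mat 1 :: real^_^_) $ r $ s else 0)" for r s
    unfolding matrix_matrix_mult_def vec_lambda_beta
    by (rule sum.cong) (auto simp: reflection_def mat_def)
  then show ?thesis by (simp add: vec_eq_iff)
qed

lemma reflection_involution' [simp]:
  "reflection l idx ** (reflection l idx ** A) = A" "A ** reflection l idx ** reflection l idx = A"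
  by (simp_all add: matrix_mul_assoc) (simp add: matrix_mul_assoc[symmetric])

lemma transpose_reflection [simp]: "transpose (reflection l idx) = reflection l idx"
  by (auto simp: transpose_def reflection_def vec_eq_iff)

lemma reflection_conjugate_SO:
  assumes "k \<in> SO"
  shows "reflection l idx ** k ** reflection l idx \<in> SO"
proof -
  have o: "orthogonal_matrix (reflection l idx)" by (simp add: orthogonal_matrix)
  have "det (reflection l idx) * det (reflection l idx) = 1"
    by (metis det_I det_mul reflection_involution)
  then show ?thesis
    using assms o by (auto simp: SO_iff orthogonal_matrix_mul det_mul)
qed

lemma representation_twisted:
  fixes \<pi> :: "real^'n^'n \<Rightarrow> complex^'d^'d"
  assumes "SO_representation \<pi>"
  shows "SO_representation (twisted l idx \<pi>)"
proof -
  interpret SO_representation \<pi> by fact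
  let ?a = "reflection l idx :: real^'n^'n"
  have "twisted l idx \<pi> (A ** B) = twisted l idx \<pi> A ** twisted l idx \<pi> B" if "A \<in> SO" "B \<in> SO" for A B
  proof -
    have "?a ** (A ** B) ** ?a = (?a ** A ** ?a) ** (?a ** B ** ?a)"
      by (simp add: matrix_mul_assoc[symmetric])
    then show ?thesis
      by (simp add: twisted_def rep_mult reflection_conjugate_SO that)
  qed
  moreover have "continuous_on SO (twisted l idx \<pi>)"
    unfolding twisted_def
    by (rule continuous_on_compose2[OF rep_continuous])
       (auto intro!: continuous_on_matrix_mult continuous_intros reflection_conjugate_SO)
  ultimately show ?thesis
    unfolding SO_representation_def representation_def by (simp add: twisted_def)
qed

lemma irreducible_twisted:
  fixes \<pi> :: "real^'n^'n \<Rightarrow> complex^'d^'d"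
  assumes "irreducible_representation \<pi>"
  shows "irreducible_representation (twisted l idx \<pi>)"
  unfolding irreducible_representation_def
proof (intro conjI allI impI)
  show "representation (twisted l idx \<pi>)"
    using assms representation_twisted[of \<pi> l idx]
    by (simp add: irreducible_representation_def SO_representation_def)
  fix W assume W: "vec.subspace W \<and> (\<forall>k\<in>SO. \<forall>w\<in>W. twisted l idx \<pi> k *v w \<in> W)"
  have "\<pi> k *v w \<in> W" if "k \<in> SO" "w \<in> W" for k w
  proof -
    have "twisted l idx \<pi> (reflection l idx ** k ** reflection l idx) *v w \<in> W"
      using W that reflection_conjugate_SO by blast
    then show ?thesis by (simp add: twisted_def matrix_mul_assoc)
  qed
  then show "W = {0} \<or> W = UNIV"
    using W assms by (simp add: irreducible_representation_def)
qed

text \<open>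
  The conjugate of \<open>exp(tX)\<close> by the reflection is a curve with tangent the conjugate of \<open>X\<close>.
\<close>

lemma differential_twisted:
  assumes "SO_representation \<pi>" and X: "transpose X = - X"
  shows "differential (twisted l idx \<pi>) X = differential \<pi> (reflection l idx ** X ** reflection l idx)"
proof -
  interpret SO_representation \<pi> by fact
  have "((\<lambda>t. \<pi> (reflection l idx ** mexp (t *\<^sub>R X) ** reflection l idx)) has_vector_derivative
      differential \<pi> (reflection l idx ** X ** reflection l idx)) (at 0)"
  proof (rule curve_has_vector_derivative)
    show "((\<lambda>t. reflection l idx ** mexp (t *\<^sub>R X) ** reflection l idx) has_vector_derivative
        reflection l idx ** X ** reflection l idx) (at 0)"
      using bounded_linear.has_vector_derivative[OF bounded_linear_matrix_mult_both mexp_has_vector_derivative[of X 0]] by simp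
    show "transpose (reflection l idx ** X ** reflection l idx) = - (reflection l idx ** X ** reflection l idx)"
      by (simp add: matrix_transpose_mul X matrix_mult_simps matrix_mul_assoc)
  qed (simp_all add: reflection_conjugate_SO mexp_skew_SO X)
  then show ?thesis
    by (simp add: differential_def[of "twisted l idx \<pi>"] matrix_exp_eq_mexp twisted_def vector_derivative_at)
qed

abbreviation "complex_reflection l idx \<equiv> complex_matrix (reflection l idx)"

lemma differential_complex_twisted:
  assumes "SO_representation \<pi>" and "X \<in> so_complex"
  shows "differential_complex (twisted l idx \<pi>) X
       = differential_complex \<pi> (complex_reflection l idx ** X ** complex_reflection l idx)"
  unfolding differential_complex_eq
  by (simp add: differential_twisted assms so_complex_parts re_im_matrix_simps matrix_mult_simps)

section \<open>Highest weight modules\<close>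

context vector_space
begin

text \<open>
  A vector in the span is annihilated by a finite product of factors \<open>A - c\<close> with \<open>c \<in> L\<close>, whereas
  such a product multiplies an eigenvector of eigenvalue \<open>a\<close> by \<open>\<Prod>(a - c)\<close>.
\<close>

lemma eigenvector_in_span_of_eigenvectors:
  assumes A: "Vector_Spaces.linear scale scale A"
    and w: "w \<in> span {u. \<exists>c\<in>L. A u = scale c u}" "A w = scale a w" "w \<noteq> 0"
  shows "a \<in> L"
proof (rule ccontr)
  assume "a \<notin> L"
  interpret A: Vector_Spaces.linear scale scale A by fact
  define N where "N = foldr (\<lambda>c u. A u - scale c u)"
  have N_simps: "N [] u = u" "N (c # cs) u = A (N cs u) - scale c (N cs u)" for c cs u
    by (simp_all add: N_def)
  have N_add: "N cs (u + u') = N cs u + N cs u'" for cs u u'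
    by (induction cs) (simp_all add: N_simps A.add scale_right_distrib)
  have N_diff: "N cs (u - u') = N cs u - N cs u'" for cs u u'
    by (induction cs) (simp_all add: N_simps A.diff scale_right_diff_distrib)
  have N_scale: "N cs (scale b u) = scale b (N cs u)" for cs u b
    by (induction cs) (simp_all add: N_simps A.scale scale_right_diff_distrib mult.commute)
  have N_0: "N cs 0 = 0" for cs
    by (induction cs) (simp_all add: N_simps)
  have N_A: "N cs (A u) = A (N cs u)" for cs u
    by (induction cs) (simp_all add: N_simps A.diff A.scale)
  have N_eigen: "N cs u = 0 \<longleftrightarrow> u = 0" if "A u = scale a u" "a \<notin> set cs" for cs u
  proof -
    have "N cs u = scale (\<Prod>c\<leftarrow>cs. a - c) u"
      using that
      by (induction cs) (simp_all add: N_simps A.scale left_diff_distrib scale_left_diff_distrib mult.commute)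
    moreover have "(\<Prod>c\<leftarrow>cs. a - c) \<noteq> 0" using that by (induction cs) auto
    ultimately show ?thesis by simp
  qed
  from w(1) have "\<exists>cs. set cs \<subseteq> L \<and> N cs w = 0"
  proof (induction rule: span_induct_alt)
    case base
    show ?case by (intro exI[of _ "[]"]) (simp add: N_simps)
  next
    case (step b x y)
    then obtain c cs where c: "c \<in> L" "A x = scale c x" and cs: "set cs \<subseteq> L" "N cs y = 0" by auto
    have "N (c # cs) x = N cs (A x - scale c x)"
      by (simp add: N_simps N_A N_diff N_scale)
    then have "N (c # cs) x = 0" using c by (simp add: N_0)
    moreover have "N (c # cs) y = 0" using cs by (simp add: N_simps)
    ultimately show ?case using c cs by (intro exI[of _ "c # cs"]) (simp add: N_add N_scale)
  qed
  then obtain cs where "set cs \<subseteq> L" "N cs w = 0" by auto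
  then show False using N_eigen[of w cs] w \<open>a \<notin> L\<close> by auto
qed

end

inductive_set words :: "('v \<Rightarrow> 'v) set \<Rightarrow> 'v \<Rightarrow> 'v set" for N v where
  empty: "v \<in> words N v"
| step: "Y \<in> N \<Longrightarrow> u \<in> words N v \<Longrightarrow> Y u \<in> words N v"

context vector_space
begin

lemma linear_span_invariant:
  assumes "Vector_Spaces.linear scale scale Z" and "\<And>u. u \<in> S \<Longrightarrow> Z u \<in> span S'" and "w \<in> span S"
  shows "Z w \<in> span S'"
proof -
  interpret Z: Vector_Spaces.linear scale scale Z by fact
  from assms(3) show ?thesis
    by (induction rule: span_induct_alt) (auto simp: Z.add Z.scale intro: span_zero span_add span_scale assms(2))
qed

text \<open>
  Induction on the length of a word, for all operators of \<open>G\<close> at once: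
  \<open>Z (Y u) = Y (Z u) + [Z, Y] u\<close>, and both \<open>Z u\<close> and \<open>[Z, Y] u\<close> are covered by the induction
  hypothesis. Only the action of \<open>G\<close> on the generator \<open>v\<close> has to be known. This replaces the
  Poincare-Birkhoff-Witt theorem.
\<close>

lemma span_words_invariant:
  assumes lin: "\<And>Z. Z \<in> G \<Longrightarrow> Vector_Spaces.linear scale scale Z"
    and N: "N \<subseteq> G"
    and bracket: "\<And>Z Y. Z \<in> G \<Longrightarrow> Y \<in> N \<Longrightarrow> (\<lambda>u. Z (Y u) - Y (Z u)) \<in> G"
    and v: "\<And>Z. Z \<in> G \<Longrightarrow> Z v \<in> span (words N v)"
    and "Z \<in> G" "w \<in> span (words N v)"
  shows "Z w \<in> span (words N v)"
proof -
  have "Z u \<in> span (words N v)" if "u \<in> words N v" "Z \<in> G" for Z u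
    using that
  proof (induction arbitrary: Z)
    case empty
    then show ?case by (rule v)
  next
    case (step Y u)
    have "Y (Z u) \<in> span (words N v)"
      by (rule linear_span_invariant[of Y "words N v"])
         (use step lin N in \<open>auto intro: span_base words.step\<close>)
    moreover have "Z (Y u) - Y (Z u) \<in> span (words N v)"
      using step.IH[OF bracket[OF step.prems step.hyps(1)]] .
    ultimately have "Y (Z u) + (Z (Y u) - Y (Z u)) \<in> span (words N v)" by (rule span_add)
    then show ?case by simp
  qed
  then show ?thesis
    using linear_span_invariant[of Z "words N v" "words N v"] lin assms(5,6) by blast
qed

end

lemma words_eigenvector:
  fixes scale :: "complex \<Rightarrow> 'v::ab_group_add \<Rightarrow> 'v"
  assumes "vector_space scale"
    and lin: "\<And>Y. Y \<in> N \<Longrightarrow> Vector_Spaces.linear scale scale Y"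
    and lower: "\<And>Y. Y \<in> N \<Longrightarrow> \<exists>c>0. \<forall>u. A (Y u) = Y (A u) - scale (complex_of_real c) (Y u)"
    and v: "A v = scale a v"
    and "w \<in> words N v"
  shows "w = v \<or> (\<exists>c>0. A w = scale (a - complex_of_real c) w)"
  using \<open>w \<in> words N v\<close>
proof induction
  case (step Y u)
  interpret vector_space scale by fact
  interpret Y: Vector_Spaces.linear scale scale Y using lin step.hyps by blast
  from lower[OF step.hyps(1)] obtain d where d: "d > 0"
    "A (Y u) = Y (A u) - scale (complex_of_real d) (Y u)" by blast
  have "\<exists>c\<ge>0. A u = scale (a - complex_of_real c) u"
    using step.IH
  proof
    assume "u = v"
    then show ?thesis using v by (intro exI[of _ 0]) simp
  qed (auto intro: less_imp_le)
  then obtain c where c: "c \<ge> 0" "A u = scale (a - complex_of_real c) u" by blast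
  have "A (Y u) = scale (a - complex_of_real (c + d)) (Y u)"
    unfolding d c by (simp add: Y.scale Y.diff scale_left_diff_distrib scale_left_distrib)
  then show ?case using c d by (intro disjI2 exI[of _ "c + d"]) auto
qed simp

text \<open>
  Every word other than \<open>v\<close> itself is an eigenvector of \<open>A\<close> with an eigenvalue strictly below
  \<open>a\<close>. Hence no new eigenvalues occur in the span, and an eigenvector of eigenvalue \<open>a\<close> differs
  from a multiple of \<open>v\<close> by a combination of lower eigenvectors, which must vanish.
\<close>

lemma eigenvectors_in_span_words:
  fixes scale :: "complex \<Rightarrow> 'v::ab_group_add \<Rightarrow> 'v"
  assumes "vector_space scale"
    and A: "Vector_Spaces.linear scale scale A"
    and lin: "\<And>Y. Y \<in> N \<Longrightarrow> Vector_Spaces.linear scale scale Y"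
    and lower: "\<And>Y. Y \<in> N \<Longrightarrow> \<exists>c>0. \<forall>u. A (Y u) = Y (A u) - scale (complex_of_real c) (Y u)"
    and v: "A v = scale a v"
    and w: "w \<in> module.span scale (words N v)"
  shows "A w = scale b w \<Longrightarrow> w \<noteq> 0 \<Longrightarrow> \<exists>c\<ge>0. b = a - complex_of_real c"
    and "A w = scale a w \<Longrightarrow> \<exists>k. w = scale k v"
proof -
  interpret vector_space scale by fact
  interpret A: Vector_Spaces.linear scale scale A by fact
  note words_eigen = words_eigenvector[where scale = scale, OF assms(1) lin lower v]
  {
    assume b: "A w = scale b w" "w \<noteq> 0"
    have "words N v \<subseteq> {u. \<exists>c\<in>{a - complex_of_real c |c. c \<ge> 0}. A u = scale c u}"
    proof
      fix u assume "u \<in> words N v"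
      then consider "u = v" | c where "c > 0" "A u = scale (a - complex_of_real c) u"
        using words_eigen by blast
      then show "u \<in> {u. \<exists>c\<in>{a - complex_of_real c |c. c \<ge> 0}. A u = scale c u}"
      proof cases
        case 1
        have "a \<in> {a - complex_of_real c |c. c \<ge> 0}" by (auto intro: exI[of _ 0])
        then show ?thesis using v 1 by blast
      qed (use less_imp_le in blast)
    qed
    then have "w \<in> span {u. \<exists>c\<in>{a - complex_of_real c |c. c \<ge> 0}. A u = scale c u}"
      using w span_mono by blast
    from eigenvector_in_span_of_eigenvectors[OF A this b]
    show "\<exists>c\<ge>0. b = a - complex_of_real c" by auto
  }
  {
    assume a: "A w = scale a w"
    let ?E = "{u. \<exists>c\<in>{a - complex_of_real c |c. c > 0}. A u = scale c u}"
    have "words N v \<subseteq> insert v ?E"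
      using words_eigen by blast
    then have "w \<in> span (insert v ?E)"
      using w span_mono by blast
    then obtain k where k: "w - scale k v \<in> span ?E"
      by (auto simp: span_breakdown_eq)
    have "A (w - scale k v) = scale a (w - scale k v)"
      by (simp add: A.diff A.scale a v algebra_simps)
    then have "w - scale k v = 0"
      using eigenvector_in_span_of_eigenvectors[OF A k, of a] by auto
    then show "\<exists>k. w = scale k v" by auto
  }
qed

section \<open>Root space decomposition\<close>

text \<open>
  The identification of \<open>u \<and> w\<close> with the skew-symmetric matrix \<open>u w\<^sup>T - w u\<^sup>T\<close>, under
  which the adjoint action becomes the natural action on bivectors.
\<close>

definition wedge :: "complex^'n \<Rightarrow> complex^'n \<Rightarrow> complex^'n^'n" where
  "wedge u w = (\<chi> r s. u $ r * w $ s - w $ r * u $ s)"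

lemma wedge_simps:
  "wedge (u + u') w = wedge u w + wedge u' w"
  "wedge u (w + w') = wedge u w + wedge u w'"
  "wedge (c *s u) w = matrix_scale c (wedge u w)"
  "wedge u (c *s w) = matrix_scale c (wedge u w)"
  "wedge u u = 0"
  by (simp_all add: wedge_def vec_eq_iff matrix_scale_def algebra_simps)

lemma so_complex_component:
  assumes "X \<in> so_complex"
  shows "X $ r $ s = - X $ s $ r"
proof -
  have "X $ r $ s = transpose X $ s $ r" by (simp add: transpose_def)
  also have "\<dots> = - X $ s $ r" using assms by (simp add: so_complex_def)
  finally show ?thesis .
qed

lemma wedge_so_complex: "wedge u w \<in> so_complex"
  by (simp add: so_complex_def wedge_def vec_eq_iff transpose_def)

text \<open>
  A skew-symmetric \<open>H\<close> acts on bivectors as a derivation, so the wedge of two eigenvectors of \<open>H\<close>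
  is an eigenvector of \<open>ad H\<close> for the sum of the eigenvalues.
\<close>

lemma lie_bracket_wedge:
  assumes "H \<in> so_complex"
  shows "lie_bracket H (wedge u w) = wedge (H *v u) w + wedge u (H *v w)"
proof -
  have H: "H $ k $ s = - H $ s $ k" for k s
    by (rule so_complex_component[OF assms])
  have 1: "(H ** wedge u w) $ r $ s = (H *v u) $ r * w $ s - (H *v w) $ r * u $ s" for r s
    by (simp add: matrix_matrix_mult_def matrix_vector_mult_def wedge_def sum_distrib_left
        sum_subtractf right_diff_distrib ac_simps)
  have 2: "(wedge u w ** H) $ r $ s = w $ r * (H *v u) $ s - u $ r * (H *v w) $ s" for r s
  proof -
    have "(wedge u w ** H) $ r $ s = (\<Sum>k\<in>UNIV. (u $ r * w $ k - w $ r * u $ k) * (- H $ s $ k))"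
      unfolding matrix_matrix_mult_def wedge_def by (simp add: H[of _ s])
    also have "\<dots> = w $ r * (H *v u) $ s - u $ r * (H *v w) $ s"
      by (simp add: matrix_vector_mult_def sum_distrib_left sum_subtractf left_diff_distrib
          right_diff_distrib sum_negf ac_simps)
    finally show ?thesis .
  qed
  show ?thesis
    unfolding lie_bracket_def vec_eq_iff vector_minus_component vector_add_component 1 2
    by (simp add: wedge_def)
qed

lemma so_complex_as_wedges:
  assumes "X \<in> so_complex"
  shows "X = (\<Sum>r\<in>UNIV. \<Sum>s\<in>UNIV. matrix_scale (X $ r $ s / 2) (wedge (axis r 1) (axis s 1)))"
proof -
  have X: "X $ k $ s = - X $ s $ k" for k s
    by (rule so_complex_component[OF assms])
  have "(\<Sum>r\<in>UNIV. \<Sum>s\<in>UNIV. matrix_scale (X $ r $ s / 2) (wedge (axis r 1) (axis s 1))) $ p $ q = X $ p $ q" for p q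
  proof -
    have "(\<Sum>r\<in>UNIV. \<Sum>s\<in>UNIV. matrix_scale (X $ r $ s / 2) (wedge (axis r 1) (axis s 1))) $ p $ q
        = (\<Sum>r\<in>UNIV. \<Sum>s\<in>UNIV. (if r = p then if s = q then X $ p $ q / 2 else 0 else 0)
            - (if s = p then if r = q then X $ q $ p / 2 else 0 else 0))"
      unfolding sum_component by (intro sum.cong refl) (auto simp: matrix_scale_def wedge_def axis_def)
    also have "\<dots> = X $ p $ q / 2 - X $ q $ p / 2"
      by (simp add: sum_subtractf) (subst sum.swap, simp)
    also have "\<dots> = X $ p $ q" using X[of p q] by simp
    finally show ?thesis .
  qed
  then show ?thesis by (simp add: vec_eq_iff)
qed

locale numbering =
  fixes l :: nat and idx :: "nat \<Rightarrow> 'n::finite"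
  assumes idx: "bij_betw idx {1..2*l} (UNIV :: 'n set)"
begin

lemma idx_eq_iff: "i \<in> {1..2*l} \<Longrightarrow> j \<in> {1..2*l} \<Longrightarrow> idx i = idx j \<longleftrightarrow> i = j"
  using inj_on_eq_iff[OF bij_betw_imp_inj_on[OF idx]] .

lemma idx_simps:
  assumes "j \<in> {1..l}" "k \<in> {1..l}"
  shows "idx (2*j - 1) \<noteq> idx (2*k)" "idx (2*k) \<noteq> idx (2*j - 1)"
    and "idx (2*j - 1) = idx (2*k - 1) \<longleftrightarrow> j = k" "idx (2*j) = idx (2*k) \<longleftrightarrow> j = k"
proof -
  have ge: "j \<ge> 1" "k \<ge> 1" and range: "2*j - 1 \<in> {1..2*l}" "2*k - 1 \<in> {1..2*l}" "2*j \<in> {1..2*l}" "2*k \<in> {1..2*l}"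
    using assms by auto
  have "2*j - 1 \<noteq> 2*k" using ge by presburger
  moreover have "2*j - 1 = 2*k - 1 \<longleftrightarrow> j = k" using ge by linarith
  ultimately show "idx (2*j - 1) \<noteq> idx (2*k)" "idx (2*k) \<noteq> idx (2*j - 1)"
    and "idx (2*j - 1) = idx (2*k - 1) \<longleftrightarrow> j = k" "idx (2*j) = idx (2*k) \<longleftrightarrow> j = k"
    using idx_eq_iff[OF range(1,4)] idx_eq_iff[OF range(1,2)] idx_eq_iff[OF range(3,4)] by simp_all
qed

text \<open>
  The vectors \<open>e\<^bsub>2j-1\<^esub> \<mp> i e\<^bsub>2j\<^esub>\<close> (for \<open>s = 1\<close> and \<open>s = -1\<close>) are the weight vectors of the natural
  representation, of weight \<open>s \<epsilon>\<^sub>j\<close>.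
\<close>

definition weight_basis :: "nat \<Rightarrow> int \<Rightarrow> complex^'n" where
  "weight_basis j s = axis (idx (2*j - 1)) 1 - (of_int s * \<i>) *s axis (idx (2*j)) 1"

lemma sum_matrix_vector:
  "(\<Sum>i\<in>I. M i) *v (x :: complex^'m) = (\<Sum>i\<in>I. M i *v x)"
  by (induction I rule: infinite_finite_induct) (simp_all add: matrix_vector_mult_add_rdistrib)

lemma matrix_vector_axis_component: "(A *v axis i (1 :: complex)) $ r = A $ r $ i"
  by (simp add: matrix_vector_mult_def axis_def if_distrib[of "\<lambda>y. _ * y"] cong: if_cong)

lemma sum_smult_delta:
  assumes "finite I" "j \<in> I"
  shows "(\<Sum>k\<in>I. x k *s (if k = j then v else 0)) = x j *s (v :: complex^'m)"
proof -
  have "(\<Sum>k\<in>I. x k *s (if k = j then v else 0)) = (\<Sum>k\<in>I. if k = j then x j *s v else 0)"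
    by (intro sum.cong) auto
  then show ?thesis using assms by simp
qed

lemma basis_so_axis:
  assumes "p \<noteq> q"
  shows "(\<chi> r s. if r = q \<and> s = p then - (1 :: complex) else if r = p \<and> s = q then 1 else 0) *v axis i 1
       = (if i = p then - axis q 1 else if i = q then axis p 1 else 0)"
  using assms unfolding vec_eq_iff matrix_vector_axis_component by (auto simp: axis_def)

lemma cartan_axis:
  assumes "j \<in> {1..l}"
  shows "cartan l idx x *v axis (idx (2*j - 1)) 1 = - (\<i> * x j) *s axis (idx (2*j)) 1"
    and "cartan l idx x *v axis (idx (2*j)) 1 = (\<i> * x j) *s axis (idx (2*j - 1)) 1"
proof -
  have "basis_so idx (2*k) (2*k - 1) *v axis (idx (2*j - 1)) 1 = (if k = j then - axis (idx (2*j)) 1 else 0)"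
    if "k \<in> {1..l}" for k
    unfolding basis_so_def
    by (subst basis_so_axis) (use idx_simps[OF assms that] idx_simps[OF that assms] idx_simps[OF that that] in auto)
  then have "(\<Sum>k=1..l. x k *s (basis_so idx (2*k) (2*k - 1) *v axis (idx (2*j - 1)) 1)) = x j *s (- axis (idx (2*j)) 1)"
    by (subst sum_smult_delta[OF finite_atLeastAtMost assms, symmetric]) (intro sum.cong, simp_all)
  then show "cartan l idx x *v axis (idx (2*j - 1)) 1 = - (\<i> * x j) *s axis (idx (2*j)) 1"
    unfolding cartan_def matrix_scale_vector sum_matrix_vector
    by (simp only:) (simp add: vec_eq_iff)
  have "basis_so idx (2*k) (2*k - 1) *v axis (idx (2*j)) 1 = (if k = j then axis (idx (2*j - 1)) 1 else 0)"
    if "k \<in> {1..l}" for k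
    unfolding basis_so_def
    by (subst basis_so_axis) (use idx_simps[OF assms that] idx_simps[OF that assms] idx_simps[OF that that] in auto)
  then have "(\<Sum>k=1..l. x k *s (basis_so idx (2*k) (2*k - 1) *v axis (idx (2*j)) 1)) = x j *s (axis (idx (2*j - 1)) 1)"
    by (subst sum_smult_delta[OF finite_atLeastAtMost assms, symmetric]) (intro sum.cong, simp_all)
  then show "cartan l idx x *v axis (idx (2*j)) 1 = (\<i> * x j) *s axis (idx (2*j - 1)) 1"
    unfolding cartan_def matrix_scale_vector sum_matrix_vector
    by (simp only:) (simp add: vec_eq_iff)
qed

lemma cartan_weight_basis:
  assumes "j \<in> {1..l}" "s \<in> {1, -1}"
  shows "cartan l idx x *v weight_basis j s = (of_int s * x j) *s weight_basis j s"
proof -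
  have "cartan l idx x *v weight_basis j s = - (\<i> * x j) *s axis (idx (2*j)) 1
      - (of_int s * \<i>) *s ((\<i> * x j) *s axis (idx (2*j - 1)) 1)"
    unfolding weight_basis_def vec.diff vec.scale cartan_axis[OF assms(1)] ..
  also have "\<dots> = (of_int s * x j) *s weight_basis j s"
    using assms(2) by (auto simp: weight_basis_def vec_eq_iff algebra_simps)
  finally show ?thesis .
qed

lemma cartan_so_complex: "cartan l idx x \<in> so_complex"
proof -
  have b: "basis_so idx (2*j) (2*j - 1) \<in> so_complex" if "j \<in> {1..l}" for j
  proof -
    have "idx (2*j) \<noteq> idx (2*j - 1)" by (rule idx_simps(2)[OF that that])
    then show ?thesis by (auto simp: so_complex_def basis_so_def transpose_def vec_eq_iff)
  qed
  have "(\<Sum>j\<in>J. matrix_scale (x j) (basis_so idx (2*j) (2*j - 1))) \<in> so_complex" if "J \<subseteq> {1..l}" for J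
    using finite_subset[OF that finite_atLeastAtMost] that
  proof (induction J rule: finite_induct)
    case empty
    show ?case by (simp add: so_complex_def transpose_additive)
  next
    case (insert i F)
    then show ?case using b[of i] by (simp add: so_complex_closed)
  qed
  then show ?thesis unfolding cartan_def by (intro so_complex_closed(2)) auto
qed

lemma weight_value_simps:
  "weight_value l (\<lambda>i. a i + b i) x = weight_value l a x + weight_value l b x"
  "weight_value l (\<lambda>i. a i - b i) x = weight_value l a x - weight_value l b x"
  "weight_value l (\<lambda>i. - a i) x = - weight_value l a x"
  "weight_value l (\<lambda>i. s * a i) x = of_int s * weight_value l a x"
  by (simp_all add: weight_value_def sum.distrib sum_subtractf sum_negf sum_distrib_left algebra_simps)

lemma weight_value_eps: "j \<in> {1..l} \<Longrightarrow> weight_value l (eps j) x = x j"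
  by (simp add: weight_value_def eps_def if_distrib[of "\<lambda>y. of_int y * _"] cong: if_cong)

lemma root_space_scale: "X \<in> root_space l idx \<alpha> \<Longrightarrow> matrix_scale c X \<in> root_space l idx \<alpha>"
  by (auto simp: root_space_def so_complex_closed lie_bracket_def matrix_scale_mult
      matrix_scale_simps(2)[symmetric] matrix_scale_simps(5) mult.commute)

lemma wedge_weight_basis_root_space:
  assumes "j \<in> {1..l}" "k \<in> {1..l}" "s \<in> {1, -1}" "t \<in> {1, -1}"
  shows "wedge (weight_basis j s) (weight_basis k t) \<in> root_space l idx (\<lambda>i. s * eps j i + t * eps k i)"
  unfolding root_space_def
  using assms
  by (auto simp: wedge_so_complex lie_bracket_wedge cartan_so_complex cartan_weight_basis weight_value_simps
      weight_value_eps wedge_simps matrix_scale_def vec_eq_iff algebra_simps simp del: One_nat_def)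

text \<open>
  The two weight vectors of one block have opposite weights; their wedge is a multiple of
  \<open>e\<^bsub>2j-1\<^esub> \<and> e\<^bsub>2j\<^esub>\<close>, which spans the corresponding line of the Cartan subalgebra. The factor \<open>2\<close>
  comes from \<open>(e - i e') \<and> (e + i e') = 2i e \<and> e'\<close>.
\<close>

lemma wedge_weight_basis_cartan:
  assumes "j \<in> {1..l}"
  shows "matrix_scale c (wedge (weight_basis j 1) (weight_basis j (-1))) = cartan l idx (\<lambda>i. if i = j then 2 * c else 0)"
proof -
  have ne: "idx (2*j) \<noteq> idx (2*j - 1)" by (rule idx_simps(2)[OF assms assms])
  have "cartan l idx (\<lambda>i. if i = j then 2 * c else 0)
      = matrix_scale \<i> (\<Sum>i=1..l. if i = j then matrix_scale (2 * c) (basis_so idx (2*j) (2*j - 1)) else 0)"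
    unfolding cartan_def
    by (intro arg_cong[where f = "matrix_scale \<i>"] sum.cong) (auto simp: matrix_scale_def vec_eq_iff)
  also have "\<dots> = matrix_scale \<i> (matrix_scale (2 * c) (basis_so idx (2*j) (2*j - 1)))"
    using assms by simp
  also have "\<dots> = matrix_scale c (wedge (weight_basis j 1) (weight_basis j (-1)))"
    using ne by (auto simp: vec_eq_iff matrix_scale_def basis_so_def wedge_def weight_basis_def axis_def)
  finally show ?thesis by simp
qed

lemma axis_as_weight_basis:
  obtains j a b where "j \<in> {1..l}" "axis r 1 = a *s weight_basis j 1 + b *s weight_basis j (-1)"
proof -
  from idx have "r \<in> idx ` {1..2*l}" by (simp add: bij_betw_def)
  then obtain i where i: "i \<in> {1..2*l}" "r = idx i" by auto
  show ?thesis
  proof (cases "even i")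
    case True
    then obtain j where "i = 2 * j" by (rule evenE)
    then show ?thesis using i
      by (intro that[of j "\<i> / 2" "- \<i> / 2"]) (auto simp: weight_basis_def vec_eq_iff field_simps)
  next
    case False
    then obtain j where "i = 2 * j + 1" by (rule oddE)
    then have "r = idx (2 * (j + 1) - 1)" "j + 1 \<in> {1..l}" using i by auto
    then show ?thesis
      by (intro that[of "j + 1" "1 / 2" "1 / 2"]) (auto simp: weight_basis_def vec_eq_iff field_simps)
  qed
qed

text \<open>
  This is the decomposition of the Lie algebra into the Cartan subalgebra and the root spaces. It is
  spanned by wedges of weight vectors; such a wedge of \<open>j\<close>-th and \<open>k\<close>-th vectors lies in the
  root space of \<open>\<plusminus>\<epsilon>\<^sub>j \<plusminus> \<epsilon>\<^sub>k\<close> if \<open>j \<noteq> k\<close>, and in the Cartan subalgebra otherwise. For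
  \<open>j < k\<close> the sign of \<open>\<epsilon>\<^sub>j\<close> decides whether the root is positive.
\<close>

theorem so_complex_induct [consumes 1, case_names cartan positive negative add]:
  assumes "X \<in> so_complex"
    and cartan: "\<And>x. P (cartan l idx x)"
    and pos: "\<And>\<alpha> X. \<alpha> \<in> positive_roots l \<Longrightarrow> X \<in> root_space l idx \<alpha> \<Longrightarrow> P X"
    and neg: "\<And>\<alpha> X. \<alpha> \<in> positive_roots l \<Longrightarrow> X \<in> root_space l idx (\<lambda>i. - \<alpha> i) \<Longrightarrow> P X"
    and add: "\<And>X Y. X \<in> so_complex \<Longrightarrow> Y \<in> so_complex \<Longrightarrow> P X \<Longrightarrow> P Y \<Longrightarrow> P (X + Y)"
  shows "P X"
proof -
  define S where "S = {X \<in> so_complex. P X}"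
  have S_add: "X + Y \<in> S" if "X \<in> S" "Y \<in> S" for X Y
    using that add by (auto simp: S_def so_complex_closed)
  have "cartan l idx (\<lambda>_. 0) = 0"
    by (simp add: cartan_def matrix_scale_def vec_eq_iff)
  then have S_0: "0 \<in> S" using cartan[of "\<lambda>_. 0"] cartan_so_complex[of "\<lambda>_. 0"] by (simp add: S_def)
  have S_sum: "(\<Sum>i\<in>I. g i) \<in> S" if "\<And>i. g i \<in> S" for I :: "'n set" and g
    by (induction I rule: infinite_finite_induct) (auto intro: S_0 S_add that)
  have upper: "matrix_scale c (wedge (weight_basis j s) (weight_basis k t)) \<in> S"
    if "j \<in> {1..l}" "k \<in> {1..l}" "j < k" "s \<in> {1, -1}" "t \<in> {1, -1}" for c j k s t
  proof -
    let ?X = "matrix_scale c (wedge (weight_basis j s) (weight_basis k t))"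
    have X: "?X \<in> root_space l idx (\<lambda>i. s * eps j i + t * eps k i)"
      by (intro root_space_scale wedge_weight_basis_root_space that)
    have plus: "(\<lambda>i. eps j i + eps k i) \<in> positive_roots l" and minus: "(\<lambda>i. eps j i - eps k i) \<in> positive_roots l"
      using that unfolding positive_roots_def by auto
    have "P ?X"
    proof (cases "s = 1")
      case True
      then show ?thesis using X pos[OF plus, of ?X] pos[OF minus, of ?X] that(5) by auto
    next
      case False
      have "(\<lambda>i. - eps j i - eps k i) = (\<lambda>i. - eps k i - eps j i)" by auto
      with False show ?thesis using X neg[OF plus, of ?X] neg[OF minus, of ?X] that(4,5) by auto
    qed
    then show ?thesis by (simp add: S_def so_complex_closed(2) wedge_so_complex)
  qed
  have generators: "matrix_scale c (wedge (weight_basis j s) (weight_basis k t)) \<in> S"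
    if "j \<in> {1..l}" "k \<in> {1..l}" "s \<in> {1, -1}" "t \<in> {1, -1}" for c j k s t
  proof -
    have flip: "matrix_scale c (wedge u w) = matrix_scale (- c) (wedge w u)" for c and u w :: "complex^'n"
      by (simp add: matrix_scale_def wedge_def vec_eq_iff algebra_simps)
    have diag: "matrix_scale c (wedge (weight_basis j 1) (weight_basis j (-1))) \<in> S" for c
      using wedge_weight_basis_cartan[OF that(1)] cartan cartan_so_complex by (simp add: S_def)
    note st = \<open>s \<in> {1, -1}\<close> \<open>t \<in> {1, -1}\<close>
    consider "j < k" | "k < j" | "j = k" "s = t" | "j = k" "s = 1" "t = -1" | "j = k" "s = -1" "t = 1"
      using st by (cases j k rule: linorder_cases) auto
    then show ?thesis
    proof cases
      case 1
      then show ?thesis using upper that by blast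
    next
      case 2
      then show ?thesis using upper[of k j t s "- c"] that flip by simp
    next
      case 3
      then show ?thesis by (simp add: wedge_simps matrix_scale_simps S_0)
    next
      case 4
      then show ?thesis using diag by simp
    next
      case 5
      then show ?thesis using diag[of "- c"] flip[of c] by simp
    qed
  qed
  have "matrix_scale c (wedge (axis r 1) (axis s 1)) \<in> S" for c r s
  proof -
    obtain j a b where j: "j \<in> {1..l}" "axis r 1 = a *s weight_basis j 1 + b *s weight_basis j (-1)" by (rule axis_as_weight_basis)
    obtain k a' b' where k: "k \<in> {1..l}" "axis s 1 = a' *s weight_basis k 1 + b' *s weight_basis k (-1)" by (rule axis_as_weight_basis)
    show ?thesis
      unfolding j k wedge_simps matrix_scale_simps
      by (intro S_add generators j k) auto
  qed
  then have "X \<in> S"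
    by (subst so_complex_as_wedges[OF assms(1)]) (intro S_sum)
  then show ?thesis by (simp add: S_def)
qed

text \<open>
  The coordinates \<open>(\<ell>, \<ell> - 1, \<dots>, 1)\<close> are positive and strictly decreasing, so every
  \<open>\<epsilon>\<^sub>j \<plusminus> \<epsilon>\<^sub>k\<close> with \<open>j < k\<close> is positive on them.
\<close>

lemma positive_root_value:
  assumes "\<alpha> \<in> positive_roots l"
  shows "\<exists>c>0. weight_value l \<alpha> (\<lambda>j. of_nat (l + 1 - j)) = complex_of_real c"
proof -
  from assms obtain j k where jk: "1 \<le> j" "j < k" "k \<le> l"
    and \<alpha>: "\<alpha> = (\<lambda>i. eps j i + eps k i) \<or> \<alpha> = (\<lambda>i. eps j i - eps k i)"
    unfolding positive_roots_def by auto
  have eq: "weight_value l (eps j) (\<lambda>j. of_nat (l + 1 - j)) = complex_of_real (real (l + 1 - j))"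
    "weight_value l (eps k) (\<lambda>j. of_nat (l + 1 - j)) = complex_of_real (real (l + 1 - k))"
    using jk by (simp_all add: weight_value_eps)
  show ?thesis
    using \<alpha>
  proof
    assume "\<alpha> = (\<lambda>i. eps j i + eps k i)"
    then show ?thesis
      using jk by (intro exI[of _ "real (l + 1 - j) + real (l + 1 - k)"]) (simp_all only: weight_value_simps eq of_real_add of_real_diff, simp)
  next
    assume "\<alpha> = (\<lambda>i. eps j i - eps k i)"
    then show ?thesis
      using jk by (intro exI[of _ "real (l + 1 - j) - real (l + 1 - k)"]) (simp_all only: weight_value_simps eq of_real_add of_real_diff, simp)
  qed
qed

end

section \<open>Highest weights of irreducible representations\<close>

text \<open>
  Modules over the complexified Lie algebra on an arbitrary complex vector space, so that the same
  results apply to a representation and to the product of two representations, whose carrier is a type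
  of pairs.
\<close>

locale so_module = vector_space scale + numbering l idx
  for scale :: "complex \<Rightarrow> 'v::ab_group_add \<Rightarrow> 'v" and l and idx :: "nat \<Rightarrow> 'n::finite" +
  fixes act :: "complex^'n^'n \<Rightarrow> 'v \<Rightarrow> 'v"
  assumes act_linear: "X \<in> so_complex \<Longrightarrow> Vector_Spaces.linear scale scale (act X)"
    and act_add: "X \<in> so_complex \<Longrightarrow> Y \<in> so_complex \<Longrightarrow> act (X + Y) u = act X u + act Y u"
    and act_scale: "X \<in> so_complex \<Longrightarrow> act (matrix_scale c X) u = scale c (act X u)"
    and act_bracket: "X \<in> so_complex \<Longrightarrow> Y \<in> so_complex \<Longrightarrow>
      act (lie_bracket X Y) u = act X (act Y u) - act Y (act X u)"
begin

definition highest_weight_vector :: "(nat \<Rightarrow> int) \<Rightarrow> 'v \<Rightarrow> bool" where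
  "highest_weight_vector m v \<longleftrightarrow>
     (\<forall>x. act (cartan l idx x) v = scale (weight_value l m x) v) \<and>
     (\<forall>\<alpha>\<in>positive_roots l. \<forall>X\<in>root_space l idx \<alpha>. act X v = 0)"

definition lowering :: "('v \<Rightarrow> 'v) set" where
  "lowering = {act Y |Y \<alpha>. \<alpha> \<in> positive_roots l \<and> Y \<in> root_space l idx (\<lambda>i. - \<alpha> i)}"

definition cyclic :: "'v \<Rightarrow> 'v set" where
  "cyclic v = span (words lowering v)"

text \<open>
  The eigenvalues of the Cartan element with coordinates \<open>(\<ell>, \<dots>, 1)\<close> measure the height of
  weights; lowering operators strictly decrease them.
\<close>

definition grading :: "'v \<Rightarrow> 'v" where
  "grading = act (cartan l idx (\<lambda>j. of_nat (l + 1 - j)))"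

definition level :: "(nat \<Rightarrow> int) \<Rightarrow> complex" where
  "level m = weight_value l m (\<lambda>j. of_nat (l + 1 - j))"

lemma root_space_so_complex: "X \<in> root_space l idx \<alpha> \<Longrightarrow> X \<in> so_complex"
  by (simp add: root_space_def)

lemma lowering_linear: "Y \<in> lowering \<Longrightarrow> Vector_Spaces.linear scale scale Y"
  by (auto simp: lowering_def intro: act_linear root_space_so_complex)

lemma lowering_grading:
  assumes "Y \<in> lowering"
  shows "\<exists>c>0. \<forall>u. grading (Y u) = Y (grading u) - scale (complex_of_real c) (Y u)"
proof -
  let ?H = "cartan l idx (\<lambda>j. of_nat (l + 1 - j))"
  from assms obtain X \<alpha> where Y: "Y = act X" and \<alpha>: "\<alpha> \<in> positive_roots l"
    and X: "X \<in> root_space l idx (\<lambda>i. - \<alpha> i)" by (auto simp: lowering_def)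
  from positive_root_value[OF \<alpha>] obtain c where c: "c > 0"
    "weight_value l \<alpha> (\<lambda>j. of_nat (l + 1 - j)) = complex_of_real c" by blast
  have "act ?H (act X u) = act X (act ?H u) - scale (complex_of_real c) (act X u)" for u
  proof -
    have "weight_value l (\<lambda>i. - \<alpha> i) (\<lambda>j. of_nat (l + 1 - j)) = - complex_of_real c"
      by (simp only: weight_value_simps c(2))
    moreover have "\<forall>x. lie_bracket (cartan l idx x) X = matrix_scale (weight_value l (\<lambda>i. - \<alpha> i) x) X"
      using X unfolding root_space_def by blast
    ultimately have "lie_bracket ?H X = matrix_scale (- complex_of_real c) X"
      by (simp only:)
    moreover have "act (lie_bracket ?H X) u = act ?H (act X u) - act X (act ?H u)"
      by (intro act_bracket cartan_so_complex root_space_so_complex[OF X])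
    ultimately show ?thesis
      by (simp add: act_scale root_space_so_complex[OF X] algebra_simps)
  qed
  then show ?thesis using c(1) by (auto simp: Y grading_def)
qed

lemma subspace_cyclic: "subspace (cyclic v)"
  by (simp add: cyclic_def)

lemma generator_in_cyclic: "v \<in> cyclic v"
  by (simp add: cyclic_def span_base words.empty)

text \<open>
  On the highest weight vector itself, Cartan elements act by scalars, positive root vectors by zero,
  and negative root vectors produce words of length one; this covers the Lie algebra.
\<close>

lemma cyclic_invariant:
  assumes v: "highest_weight_vector m v" and "X \<in> so_complex" "w \<in> cyclic v"
  shows "act X w \<in> cyclic v"
  unfolding cyclic_def
proof (rule span_words_invariant[where G = "act ` so_complex" and Z = "act X"])
  show "Vector_Spaces.linear scale scale Z" if "Z \<in> act ` so_complex" for Z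
    using that act_linear by auto
  show "lowering \<subseteq> act ` so_complex"
    using root_space_so_complex by (auto simp: lowering_def)
  show "(\<lambda>u. Z (Y u) - Y (Z u)) \<in> act ` so_complex" if "Z \<in> act ` so_complex" "Y \<in> lowering" for Z Y
  proof -
    from that obtain X1 X2 where X: "X1 \<in> so_complex" "X2 \<in> so_complex" "Z = act X1" "Y = act X2"
      using root_space_so_complex by (auto simp: lowering_def)
    then have "(\<lambda>u. Z (Y u) - Y (Z u)) = act (lie_bracket X1 X2)"
      by (simp add: fun_eq_iff act_bracket)
    then show ?thesis using X so_complex_closed(3) by auto
  qed
  show "Z v \<in> span (words lowering v)" if Z: "Z \<in> act ` so_complex" for Z
  proof -
    from Z obtain X where X: "X \<in> so_complex" and "Z = act X" by blast
    from X have "act X v \<in> span (words lowering v)"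
    proof (induction X rule: so_complex_induct)
      case (cartan x)
      show ?case using v by (auto simp: highest_weight_vector_def intro: span_scale span_base words.empty)
    next
      case (positive \<alpha> X)
      then show ?case using v by (auto simp: highest_weight_vector_def span_zero)
    next
      case (negative \<alpha> X)
      then have "act X \<in> lowering" unfolding lowering_def by blast
      then show ?case by (rule span_base[OF words.step[OF _ words.empty]])
    next
      case (add X Y)
      then show ?case by (simp add: act_add span_add)
    qed
    then show ?thesis using \<open>Z = act X\<close> by simp
  qed
qed (use assms in \<open>auto simp: cyclic_def\<close>)

lemma grading_highest_weight_vector:
  "highest_weight_vector m v \<Longrightarrow> grading v = scale (level m) v"
  by (simp add: highest_weight_vector_def grading_def level_def)

lemma cyclic_eigenvector:
  assumes v: "highest_weight_vector m v" and w: "w \<in> cyclic v"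
  shows "grading w = scale b w \<Longrightarrow> w \<noteq> 0 \<Longrightarrow> \<exists>c\<ge>0. b = level m - complex_of_real c"
    and "grading w = scale (level m) w \<Longrightarrow> \<exists>k. w = scale k v"
proof -
  have lin: "Vector_Spaces.linear scale scale grading"
    unfolding grading_def by (intro act_linear cartan_so_complex)
  note * = eigenvectors_in_span_words[where scale = scale and A = grading and N = lowering,
      OF vector_space_axioms lin lowering_linear lowering_grading grading_highest_weight_vector[OF v] w[unfolded cyclic_def]]
  show "grading w = scale b w \<Longrightarrow> w \<noteq> 0 \<Longrightarrow> \<exists>c\<ge>0. b = level m - complex_of_real c"
    by (rule *(1))
  show "grading w = scale (level m) w \<Longrightarrow> \<exists>k. w = scale k v"
    by (rule *(2))
qed

end

lemma lie_bracket_vector: "lie_bracket A B *v u = A *v (B *v u) - B *v (A *v u)"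
  by (simp add: lie_bracket_def matrix_vector_mult_diff_rdistrib matrix_vector_mul_assoc)

lemma representation_so_module:
  assumes "SO_representation \<pi>" "numbering l idx"
  shows "so_module (*s) l idx (\<lambda>X v. differential_complex \<pi> X *v v)"
proof -
  interpret SO_representation \<pi> by fact
  interpret numbering l idx by fact
  show ?thesis
    by unfold_locales
       (simp_all add: differential_complex_add differential_complex_scale differential_complex_bracket
         matrix_scale_vector lie_bracket_vector matrix_vector_mult_add_rdistrib vec.add vec.scale)
qed

definition pair_scale :: "complex \<Rightarrow> (complex^'d) \<times> (complex^'e) \<Rightarrow> (complex^'d) \<times> (complex^'e)" where
  "pair_scale c p = (c *s fst p, c *s snd p)"

definition pair_act ::
  "(real^'n^'n \<Rightarrow> complex^'d^'d) \<Rightarrow> (real^'n^'n \<Rightarrow> complex^'e^'e) \<Rightarrow>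
    complex^'n^'n \<Rightarrow> (complex^'d) \<times> (complex^'e) \<Rightarrow> (complex^'d) \<times> (complex^'e)" where
  "pair_act \<pi> \<rho> X p = (differential_complex \<pi> X *v fst p, differential_complex \<rho> X *v snd p)"

lemma pair_so_module:
  assumes "SO_representation \<pi>" "SO_representation \<rho>" "numbering l idx"
  shows "so_module pair_scale l idx (pair_act \<pi> \<rho>)"
proof -
  interpret P: so_module "(*s)" l idx "\<lambda>X v. differential_complex \<pi> X *v v"
    by (rule representation_so_module) fact+
  interpret R: so_module "(*s)" l idx "\<lambda>X v. differential_complex \<rho> X *v v"
    by (rule representation_so_module) fact+
  have vs: "vector_space (pair_scale :: complex \<Rightarrow> (complex^'d) \<times> (complex^'e) \<Rightarrow> _)"
    by unfold_locales (auto simp: pair_scale_def vec.scale_right_distrib vec.scale_left_distrib)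
  then interpret vector_space "pair_scale :: complex \<Rightarrow> (complex^'b) \<times> (complex^'c) \<Rightarrow> _" .
  show ?thesis
    by unfold_locales
       (auto simp: pair_scale_def pair_act_def vec.scale_right_distrib vec.scale_left_distrib
         vec.add vec.scale P.act_add P.act_scale P.act_bracket R.act_add R.act_scale R.act_bracket)
qed

lemma highest_weight_iff:
  assumes "SO_representation \<pi>" "numbering l idx"
  shows "highest_weight l idx \<pi> m \<longleftrightarrow>
    (\<exists>v\<noteq>0. so_module.highest_weight_vector (*s) l idx (\<lambda>X v. differential_complex \<pi> X *v v) m v)"
proof -
  interpret P: so_module "(*s)" l idx "\<lambda>X v. differential_complex \<pi> X *v v"
    by (rule representation_so_module) fact+
  show ?thesis
    unfolding highest_weight_def weight_vector_def P.highest_weight_vector_def by auto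
qed

lemma irreducible_SO_representation: "irreducible_representation \<pi> \<Longrightarrow> SO_representation \<pi>"
  by (simp add: irreducible_representation_def SO_representation_def)

lemma irreducible_differential:
  assumes "irreducible_representation \<pi>" "vec.subspace W"
    and "\<And>X w. X \<in> so_complex \<Longrightarrow> w \<in> W \<Longrightarrow> differential_complex \<pi> X *v w \<in> W"
  shows "W = {0} \<or> W = UNIV"
  using SO_representation.subspace_invariant[OF irreducible_SO_representation[OF assms(1)] assms(2,3)]
    assms(1,2) unfolding irreducible_representation_def by blast

text \<open>
  By irreducibility each highest weight vector generates the whole space, so the level of each weight is
  at most that of the other. Once the levels agree, the two vectors are proportional, and so all Cartan
  elements act on them by the same scalars.
\<close>

theorem highest_weight_unique:
  assumes irr: "irreducible_representation \<pi>" and num: "numbering l idx"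
    and m: "highest_weight l idx \<pi> m" and m': "highest_weight l idx \<pi> m'"
    and j: "j \<in> {1..l}"
  shows "m j = m' j"
proof -
  note rep = irreducible_SO_representation[OF irr]
  interpret P: so_module "(*s)" l idx "\<lambda>X v. differential_complex \<pi> X *v v"
    by (rule representation_so_module) fact+
  have full: "P.cyclic v = UNIV" if "v \<noteq> 0" "P.highest_weight_vector m v" for m v
    using irreducible_differential[OF irr P.subspace_cyclic P.cyclic_invariant[OF that(2)]]
      P.generator_in_cyclic[of v] that(1) by auto
  from m m' obtain v v' where v: "v \<noteq> 0" "P.highest_weight_vector m v"
    and v': "v' \<noteq> 0" "P.highest_weight_vector m' v'"
    unfolding highest_weight_iff[OF rep num] by blast
  obtain c where c: "c \<ge> 0" "P.level m' = P.level m - complex_of_real c"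
    using P.cyclic_eigenvector(1)[OF v(2) _ P.grading_highest_weight_vector[OF v'(2)] v'(1)] full[OF v] by auto
  obtain c' where c': "c' \<ge> 0" "P.level m = P.level m' - complex_of_real c'"
    using P.cyclic_eigenvector(1)[OF v'(2) _ P.grading_highest_weight_vector[OF v(2)] v(1)] full[OF v'] by auto
  have "c + c' = 0" using c(2) c'(2) by simp
  then have "c = 0" using c(1) c'(1) by simp
  then have "P.grading v' = P.level m *s v'"
    using P.grading_highest_weight_vector[OF v'(2)] c(2) by simp
  then obtain k where k: "v' = k *s v"
    using P.cyclic_eigenvector(2)[OF v(2), of v'] full[OF v] by auto
  let ?x = "\<lambda>i. if i = j then 1 else (0 :: complex)"
  have "weight_value l m ?x *s v' = k *s (weight_value l m ?x *s v)"
    by (simp add: k mult.commute)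
  also have "\<dots> = differential_complex \<pi> (cartan l idx ?x) *v v'"
    using v(2) unfolding P.highest_weight_vector_def k vec.scale by simp
  also have "\<dots> = weight_value l m' ?x *s v'"
    using v'(2) unfolding P.highest_weight_vector_def by simp
  finally have "weight_value l m ?x = weight_value l m' ?x"
    using v'(1) by simp
  moreover have "weight_value l n ?x = of_int (n j)" for n
    using j by (simp add: weight_value_def if_distrib[of "\<lambda>y. _ * y"] cong: if_cong)
  ultimately show ?thesis by simp
qed

text \<open>
  Let \<open>W\<close> be the submodule of the product generated by the pair \<open>(v, v')\<close> of highest weight vectors.
  Its top level is the line through \<open>(v, v')\<close>, so it contains neither \<open>(v, 0)\<close> nor \<open>(0, v')\<close>; by
  irreducibility its intersections with the two factors are zero. Its projection to the first factor is
  everything, again by irreducibility. Hence \<open>W\<close> is the graph of an injective linear map, which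
  intertwines the differentials because \<open>W\<close> is a submodule.
\<close>

theorem equivalent_of_same_highest_weight:
  fixes \<pi> \<rho> :: "real^'n^'n \<Rightarrow> complex^'d^'d"
  assumes irr: "irreducible_representation \<pi>" "irreducible_representation \<rho>" and num: "numbering l idx"
    and m: "highest_weight l idx \<pi> m" "highest_weight l idx \<rho> m"
  shows "equivalent_representations \<pi> \<rho>"
proof -
  note rep = irr[THEN irreducible_SO_representation]
  interpret P: so_module "(*s)" l idx "\<lambda>X v. differential_complex \<pi> X *v v"
    by (rule representation_so_module) fact+
  interpret R: so_module "(*s)" l idx "\<lambda>X v. differential_complex \<rho> X *v v"
    by (rule representation_so_module) fact+
  interpret PR: so_module pair_scale l idx "pair_act \<pi> \<rho>"
    by (rule pair_so_module) fact+
  from m obtain v v' where v: "v \<noteq> 0" "P.highest_weight_vector m v"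
    and v': "v' \<noteq> 0" "R.highest_weight_vector m v'"
    unfolding highest_weight_iff[OF rep(1) num] highest_weight_iff[OF rep(2) num] by blast
  have vv': "PR.highest_weight_vector m (v, v')"
    using v(2) v'(2)
    unfolding PR.highest_weight_vector_def P.highest_weight_vector_def R.highest_weight_vector_def
    by (simp add: pair_act_def pair_scale_def zero_prod_def)
  define W where "W = PR.cyclic (v, v')"
  have W_0: "(0, 0) \<in> W" and W_add: "(u, w) \<in> W \<Longrightarrow> (u', w') \<in> W \<Longrightarrow> (u + u', w + w') \<in> W"
    and W_diff: "(u, w) \<in> W \<Longrightarrow> (u', w') \<in> W \<Longrightarrow> (u - u', w - w') \<in> W"
    and W_scale: "(u, w) \<in> W \<Longrightarrow> (c *s u, c *s w) \<in> W" for u w u' w' c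
    using PR.subspace_0[OF PR.subspace_cyclic] PR.subspace_add[OF PR.subspace_cyclic, of "(u, w)" _ "(u', w')"]
      PR.subspace_diff[OF PR.subspace_cyclic, of "(u, w)" _ "(u', w')"]
      PR.subspace_scale[OF PR.subspace_cyclic, of "(u, w)" _ c]
    by (auto simp: W_def pair_scale_def zero_prod_def)
  have W_act: "(differential_complex \<pi> X *v u, differential_complex \<rho> X *v w) \<in> W"
    if "X \<in> so_complex" "(u, w) \<in> W" for X u w
    using PR.cyclic_invariant[OF vv' that(1), of "(u, w)"] that(2) by (simp add: W_def pair_act_def)
  have W_top: "\<exists>k. (u, w) = (k *s v, k *s v')"
    if "(u, w) \<in> W" "P.grading u = P.level m *s u" "R.grading w = P.level m *s w" for u w
  proof -
    have "PR.grading (u, w) = pair_scale (PR.level m) (u, w)"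
      using that(2,3)
      by (simp add: PR.grading_def P.grading_def R.grading_def pair_act_def pair_scale_def P.level_def PR.level_def)
    from PR.cyclic_eigenvector(2)[OF vv' that(1)[unfolded W_def] this]
    show ?thesis by (simp add: pair_scale_def)
  qed
  have top_v: "P.grading v = P.level m *s v" "R.grading v' = P.level m *s v'"
    using P.grading_highest_weight_vector[OF v(2)] R.grading_highest_weight_vector[OF v'(2)]
    by (simp_all add: P.level_def R.level_def)
  have kernel_left: "u = 0" if "(u, 0) \<in> W" for u
  proof -
    have "{u. (u, 0) \<in> W} = {0} \<or> {u. (u, 0) \<in> W} = UNIV"
    proof (rule irreducible_differential[OF irr(1)])
      show "vec.subspace {u. (u, 0) \<in> W}"
        using W_0 W_add[of _ 0 _ 0] W_scale[of _ 0] by (auto intro!: vec.subspaceI)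
    qed (use W_act[of _ _ 0] in auto)
    moreover have "(v, 0) \<notin> W"
    proof
      assume "(v, 0) \<in> W"
      with W_top[of v 0] top_v obtain k where "v = k *s v" "0 = k *s v'"
        by (auto simp: R.grading_def)
      then show False using v(1) v'(1) by auto
    qed
    ultimately show ?thesis using that by auto
  qed
  have kernel_right: "w = 0" if "(0, w) \<in> W" for w
  proof -
    have "{w. (0, w) \<in> W} = {0} \<or> {w. (0, w) \<in> W} = UNIV"
    proof (rule irreducible_differential[OF irr(2)])
      show "vec.subspace {w. (0, w) \<in> W}"
        using W_0 W_add[of 0 _ 0] W_scale[of 0] by (auto intro!: vec.subspaceI)
    qed (use W_act[of _ 0] in auto)
    moreover have "(0, v') \<notin> W"
    proof
      assume "(0, v') \<in> W"
      with W_top[of 0 v'] top_v obtain k where "0 = k *s v" "v' = k *s v'"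
        by (auto simp: P.grading_def)
      then show False using v(1) v'(1) by auto
    qed
    ultimately show ?thesis using that by auto
  qed
  have "fst ` W = {0} \<or> fst ` W = UNIV"
  proof (rule irreducible_differential[OF irr(1)])
    show "vec.subspace (fst ` W)"
    proof (rule vec.subspaceI)
      show "0 \<in> fst ` W" using W_0 by force
      show "x + y \<in> fst ` W" if "x \<in> fst ` W" "y \<in> fst ` W" for x y
        using that W_add by force
      show "c *s x \<in> fst ` W" if "x \<in> fst ` W" for c x
        using that W_scale by force
    qed
    show "differential_complex \<pi> X *v u \<in> fst ` W" if "X \<in> so_complex" "u \<in> fst ` W" for X u
      using that W_act by force
  qed
  moreover have "v \<in> fst ` W"
    using PR.generator_in_cyclic[of "(v, v')"] unfolding W_def by force
  ultimately have "fst ` W = UNIV" using v(1) by auto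
  then have "\<forall>u. \<exists>w. (u, w) \<in> W" by (metis UNIV_I imageE prod.collapse)
  then obtain t where t: "\<And>u. (u, t u) \<in> W" by metis
  have t_eq: "t u = w" if "(u, w) \<in> W" for u w
    using kernel_right[of "t u - w"] W_diff[OF t[of u] that] by simp
  have t_lin: "Vector_Spaces.linear (*s) (*s) t"
    by unfold_locales (auto intro!: t_eq W_add W_scale t)
  define T where "T = matrix t"
  have T: "T *v u = t u" for u
    unfolding T_def by (rule matrix_works[OF t_lin])
  have "u = 0" if "T *v u = 0" for u
    using kernel_left[of u] t[of u] that by (simp add: T)
  then have "invertible T"
    by (metis invertible_left_inverse matrix_left_invertible_ker)
  moreover have "T ** differential_complex \<pi> X = differential_complex \<rho> X ** T" if "X \<in> so_complex" for X
    unfolding matrix_eq matrix_vector_mul_assoc[symmetric] T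
    using t_eq[OF W_act[OF that t]] by simp
  ultimately show ?thesis
    unfolding equivalent_representations_def using intertwiner_of_differential[OF rep] by blast
qed

lemma highest_weight_equivalent:
  assumes "SO_representation \<pi>" "SO_representation \<rho>" and num: "numbering l idx"
    and eq: "equivalent_representations \<pi> \<rho>" and m: "highest_weight l idx \<pi> m"
  shows "highest_weight l idx \<rho> m"
proof -
  interpret numbering l idx by fact
  from eq obtain T where T: "invertible T" "\<And>k. k \<in> SO \<Longrightarrow> T ** \<pi> k = \<rho> k ** T"
    unfolding equivalent_representations_def by blast
  have act: "differential_complex \<rho> X *v (T *v u) = T *v (differential_complex \<pi> X *v u)"
    if "X \<in> so_complex" for X u
    using differential_of_intertwiner[OF assms(1,2) T(2) that] by (simp add: matrix_vector_mul_assoc)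
  from m obtain v where v: "v \<noteq> 0" "\<And>x. differential_complex \<pi> (cartan l idx x) *v v = weight_value l m x *s v"
    "\<And>\<alpha> X. \<alpha> \<in> positive_roots l \<Longrightarrow> X \<in> root_space l idx \<alpha> \<Longrightarrow> differential_complex \<pi> X *v v = 0"
    unfolding highest_weight_def weight_vector_def by blast
  have "T *v v \<noteq> 0"
    using T(1) v(1) by (metis invertible_left_inverse matrix_left_invertible_ker)
  moreover have "X \<in> root_space l idx \<alpha> \<Longrightarrow> X \<in> so_complex" for X \<alpha>
    by (simp add: root_space_def)
  ultimately show ?thesis
    unfolding highest_weight_def weight_vector_def
    by (intro exI[of _ "T *v v"]) (auto simp: act cartan_so_complex v vec.scale)
qed

corollary equivalent_iff_same_highest_weight:
  fixes \<pi> \<rho> :: "real^'n^'n \<Rightarrow> complex^'d^'d"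
  assumes irr: "irreducible_representation \<pi>" "irreducible_representation \<rho>" and num: "numbering l idx"
    and m: "highest_weight l idx \<pi> m" "highest_weight l idx \<rho> m'"
  shows "equivalent_representations \<pi> \<rho> \<longleftrightarrow> (\<forall>j\<in>{1..l}. m j = m' j)"
proof
  assume "equivalent_representations \<pi> \<rho>"
  then have "highest_weight l idx \<rho> m"
    using highest_weight_equivalent[OF irr[THEN irreducible_SO_representation] num] m(1) by blast
  then show "\<forall>j\<in>{1..l}. m j = m' j"
    using highest_weight_unique[OF irr(2) num _ m(2)] by blast
next
  assume "\<forall>j\<in>{1..l}. m j = m' j"
  then have "weight_value l m = weight_value l m'"
    by (auto simp: weight_value_def fun_eq_iff intro!: sum.cong)
  then have "highest_weight l idx \<rho> m"
    using m(2) by (simp add: highest_weight_def weight_vector_def)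
  then show "equivalent_representations \<pi> \<rho>"
    by (rule equivalent_of_same_highest_weight[OF irr num m(1)])
qed

section \<open>Conjugation by the reflection\<close>

text \<open>
  The action of the reflection on coordinates of the Cartan subalgebra and, dually, on weights.
\<close>

definition flip :: "nat \<Rightarrow> (nat \<Rightarrow> 'a::ab_group_add) \<Rightarrow> nat \<Rightarrow> 'a" where
  "flip l a = a(l := - a l)"

lemma weight_value_flip: "weight_value l (flip l c) x = weight_value l c (flip l x)"
  unfolding weight_value_def by (intro sum.cong) (auto simp: flip_def)

text \<open>
  Only roots with \<open>k = \<ell>\<close> change, and for them the two signs are interchanged.
\<close>

lemma flip_positive_root:
  assumes "\<alpha> \<in> positive_roots l"
  shows "flip l \<alpha> \<in> positive_roots l"
proof -
  from assms obtain j k where jk: "1 \<le> j" "j < k" "k \<le> l"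
    and \<alpha>: "\<alpha> = (\<lambda>i. eps j i + eps k i) \<or> \<alpha> = (\<lambda>i. eps j i - eps k i)"
    unfolding positive_roots_def by auto
  have "flip l \<alpha> = (\<lambda>i. eps j i + eps k i) \<or> flip l \<alpha> = (\<lambda>i. eps j i - eps k i)"
  proof (cases "k = l")
    case True
    then show ?thesis using \<alpha> jk by (auto simp: flip_def eps_def fun_eq_iff)
  next
    case False
    then show ?thesis using \<alpha> jk by (auto simp: flip_def eps_def fun_eq_iff)
  qed
  then show ?thesis using jk unfolding positive_roots_def by auto
qed

context numbering
begin

abbreviation "\<sigma> \<equiv> complex_reflection l idx"

lemma complex_reflection_involution: "\<sigma> ** \<sigma> = mat 1"
proof -
  have "complex_matrix A ** complex_matrix B = complex_matrix (A ** B)" for A B :: "real^'n^'n"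
    by (simp add: complex_matrix_def matrix_matrix_mult_def vec_eq_iff)
  moreover have "complex_matrix (mat 1 :: real^'n^'n) = mat 1"
    by (simp add: complex_matrix_def mat_def vec_eq_iff)
  ultimately show ?thesis by simp
qed

lemma conjugate_component:
  "(\<sigma> ** X ** \<sigma>) $ r $ s
    = (if r = idx (2*l) then -1 else 1) * (if s = idx (2*l) then -1 else 1) * X $ r $ s"
proof -
  have 1: "(\<sigma> ** X) $ r $ s = (if r = idx (2*l) then -1 else 1) * X $ r $ s" for r s
  proof -
    have "(\<sigma> ** X) $ r $ s = (\<Sum>k\<in>UNIV. if k = r then (if r = idx (2*l) then -1 else 1) * X $ r $ s else 0)"
      unfolding matrix_matrix_mult_def vec_lambda_beta
      by (rule sum.cong) (auto simp: complex_matrix_def reflection_def)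
    then show ?thesis by simp
  qed
  have "(\<sigma> ** X ** \<sigma>) $ r $ s = (\<Sum>k\<in>UNIV. if k = s then (if s = idx (2*l) then -1 else 1) * (\<sigma> ** X) $ r $ s else 0)"
    unfolding matrix_matrix_mult_def[of "\<sigma> ** X"] vec_lambda_beta
    by (rule sum.cong) (auto simp: complex_matrix_def reflection_def)
  then show ?thesis by (simp add: 1)
qed

lemma conjugate_cartan: "l \<ge> 1 \<Longrightarrow> \<sigma> ** cartan l idx x ** \<sigma> = cartan l idx (flip l x)"
proof -
  assume "l \<ge> 1"
  then have l: "l \<in> {1..l}" by simp
  have "x j * (\<sigma> ** basis_so idx (2*j) (2*j - 1) ** \<sigma>) $ r $ s = flip l x j * basis_so idx (2*j) (2*j - 1) $ r $ s"
    if "j \<in> {1..l}" for j r s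
    unfolding conjugate_component basis_so_def flip_def
    using idx_simps[OF that l] idx_simps[OF l that] by auto
  note * = this[unfolded conjugate_component]
  have "(\<sigma> ** cartan l idx x ** \<sigma>) $ r $ s = cartan l idx (flip l x) $ r $ s" for r s
  proof -
    have "(\<sigma> ** cartan l idx x ** \<sigma>) $ r $ s = \<i> * (\<Sum>j=1..l. x j *
        ((if r = idx (2*l) then -1 else 1) * (if s = idx (2*l) then -1 else 1) * basis_so idx (2*j) (2*j - 1) $ r $ s))"
      unfolding conjugate_component by (simp add: cartan_def matrix_scale_def sum_distrib_left ac_simps)
    also have "\<dots> = \<i> * (\<Sum>j=1..l. flip l x j * basis_so idx (2*j) (2*j - 1) $ r $ s)"
      by (intro arg_cong[where f = "(*) \<i>"] sum.cong refl *)
    also have "\<dots> = cartan l idx (flip l x) $ r $ s"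
      by (simp add: cartan_def matrix_scale_def)
    finally show ?thesis .
  qed
  then show ?thesis by (simp add: vec_eq_iff)
qed

text \<open>
  Conjugation by the reflection is an automorphism of the Lie algebra that acts on the Cartan
  subalgebra by \<open>flip\<close>.
\<close>

lemma conjugate_root_space:
  assumes "l \<ge> 1" and X: "X \<in> root_space l idx \<alpha>"
  shows "\<sigma> ** X ** \<sigma> \<in> root_space l idx (flip l \<alpha>)"
proof -
  have so: "X \<in> so_complex" using X by (simp add: root_space_def)
  have "\<sigma> ** X ** \<sigma> \<in> so_complex"
  proof -
    have "(\<sigma> ** X ** \<sigma>) $ s $ r = - (\<sigma> ** X ** \<sigma>) $ r $ s" for r s
      unfolding conjugate_component so_complex_component[OF so, of s r] by simp
    then have "transpose (\<sigma> ** X ** \<sigma>) $ r $ s = (- (\<sigma> ** X ** \<sigma>)) $ r $ s" for r s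
      unfolding transpose_def vec_lambda_beta vector_uminus_component .
    then have "transpose (\<sigma> ** X ** \<sigma>) = - (\<sigma> ** X ** \<sigma>)"
      unfolding vec_eq_iff by (intro allI)
    then show ?thesis by (simp only: so_complex_def mem_Collect_eq)
  qed
  moreover have "lie_bracket (cartan l idx x) (\<sigma> ** X ** \<sigma>) = matrix_scale (weight_value l (flip l \<alpha>) x) (\<sigma> ** X ** \<sigma>)" for x
  proof -
    have flip: "flip l (flip l x) = x" by (simp add: flip_def)
    have cancel: "\<sigma> ** (\<sigma> ** M) = M" for M :: "complex^'n^'n"
      by (simp add: matrix_mul_assoc complex_reflection_involution)
    let ?H = "cartan l idx (flip l x)"
    have "cartan l idx x = \<sigma> ** ?H ** \<sigma>"
      by (simp add: conjugate_cartan[OF assms(1)] flip)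
    then have "lie_bracket (cartan l idx x) (\<sigma> ** X ** \<sigma>) = \<sigma> ** lie_bracket ?H X ** \<sigma>"
      by (simp add: lie_bracket_def matrix_mult_simps matrix_mul_assoc[symmetric] cancel)
    also have "lie_bracket ?H X = matrix_scale (weight_value l \<alpha> (flip l x)) X"
      using X by (simp add: root_space_def)
    finally show ?thesis by (simp add: matrix_scale_mult weight_value_flip)
  qed
  ultimately show ?thesis by (simp add: root_space_def)
qed

text \<open>
  The same vector serves for the twisted representation.
\<close>

lemma highest_weight_twisted:
  assumes "l \<ge> 1" "SO_representation \<pi>" "highest_weight l idx \<pi> m"
  shows "highest_weight l idx (twisted l idx \<pi>) (flip l m)"
proof -
  from assms(3) obtain v where v: "v \<noteq> 0"
    "\<And>x. differential_complex \<pi> (cartan l idx x) *v v = weight_value l m x *s v"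
    "\<And>\<alpha> X. \<alpha> \<in> positive_roots l \<Longrightarrow> X \<in> root_space l idx \<alpha> \<Longrightarrow> differential_complex \<pi> X *v v = 0"
    unfolding highest_weight_def weight_vector_def by blast
  have "differential_complex (twisted l idx \<pi>) (cartan l idx x) *v v = weight_value l (flip l m) x *s v" for x
    by (simp add: differential_complex_twisted[OF assms(2) cartan_so_complex] conjugate_cartan[OF assms(1)]
        v(2) weight_value_flip)
  moreover have "differential_complex (twisted l idx \<pi>) X *v v = 0"
    if "\<alpha> \<in> positive_roots l" "X \<in> root_space l idx \<alpha>" for \<alpha> X
  proof -
    have "X \<in> so_complex" using that(2) by (simp add: root_space_def)
    then show ?thesis
      using v(3)[OF flip_positive_root[OF that(1)] conjugate_root_space[OF assms(1) that(2)]]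
      by (simp add: differential_complex_twisted[OF assms(2)])
  qed
  ultimately show ?thesis
    unfolding highest_weight_def weight_vector_def using v(1) by blast
qed

end

theorem corollary2p6:
  fixes l :: nat
    and idx :: "nat \<Rightarrow> 'n::finite"
    and \<pi> :: "real^'n^'n \<Rightarrow> complex^'d^'d"
    and m :: "nat \<Rightarrow> int"
  assumes "l \<ge> 1"
    and "bij_betw idx {1..2*l} (UNIV :: 'n set)"
    and "irreducible_representation \<pi>"
    and "highest_weight l idx \<pi> m"
  shows "equivalent_representations \<pi> (twisted l idx \<pi>) \<longleftrightarrow> m l = 0"
proof -
  interpret numbering l idx by unfold_locales fact
  have "highest_weight l idx (twisted l idx \<pi>) (flip l m)"
    using highest_weight_twisted assms irreducible_SO_representation by blast
  then have "equivalent_representations \<pi> (twisted l idx \<pi>) \<longleftrightarrow> (\<forall>j\<in>{1..l}. m j = flip l m j)"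
    by (rule equivalent_iff_same_highest_weight[OF assms(3) irreducible_twisted[OF assms(3)] numbering_axioms assms(4)])
  also have "\<dots> \<longleftrightarrow> m l = 0"
    using assms(1) by (auto simp: flip_def)
  finally show ?thesis .
qed

end
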